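(* Every Hilbert $*$-category is monotone complete. That is, if $\mathbf{C}$ is a Hilbert $*$-category, then for every object $A$ of $\mathbf{C}$, every increasing net of Hermitian elements of $\mathbf{C}(A,A)$ that has an upper bound has a supremum.
   Context: A $*$-category is a category equipped with a choice of morphism $f^*\colon Y\to X$ for each morphism $f\colon X\to Y$ such that $1^*=1$, $(gf)^*=f^*g^*$ and $(f^* )^*=f$. A morphism $f$ is isometric (an isometry) if $f^*f=1$, and coisometric (a coisometry) if $ff^*=1$. In a $*$-category with a zero object, a binary product $(r_1\colon X\to X_1,\ r_2\colon X\to X_2)$ is orthonormal if $r_1,r_2$ are coisometries and $r_1r_2^*=0$. A pre-Hilbert $*$-category is a $*$-category with a zero object, in which every pair of objects has an orthonormal product (written $X_1\oplus X_2$), every morphism has a kernel that is an isometry, and, for each object $X$, the diagonal $X\to X\oplus X$ (with both components $1$) is a kernel of some morphism. It is known that every pre-Hilbert $*$-category is canonically enriched in rational vector spaces, with $(f+g)^*=f^*+g^*$, orthonormal products being biproducts. An endomorphism $a$ is Hermitian if $a^*=a$. For each object $A$, the Hermitian elements of $\mathbf{C}(A,A)$ are partially ordered by: $f\le g$ iff $g-f=h^*h$ for some morphism $h\colon A\to X$ (for some object $X$). A morphism $f$ is a contraction if $f^*f\le 1$. A directed set is a non-empty preordered set in which every pair of elements has an upper bound. An increasing net in $\mathbf{C}(A,A)$ is a family $(a_j)_{j\in J}$ of Hermitian elements indexed by a directed set $J$ with $a_j\le a_k$ whenever $j\le k$. An upper bound is a Hermitian $b$ with $a_j\le b$ for all $j$;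 the supremum is the least upper bound. A codirected diagram $(f_{j\le k}\colon X_k\to X_j)_{j,k\in J}$ consists of objects $X_j$ indexed by a directed set $J$ and morphisms $f_{j\le k}\colon X_k\to X_j$ for all $j\le k$, with $f_{j\le j}=1$ and $f_{j\le k}f_{k\le l}=f_{j\le l}$. A cone on it is a family $(g_j\colon Y\to X_j)_{j\in J}$ with $f_{j\le k}g_k=g_j$ for all $j\le k$. Now suppose all $f_{j\le k}$ are contractions in a pre-Hilbert $*$-category $\mathbf{C}$; then $(g_j^*g_j)_{j\in J}$ is an increasing net in $\mathbf{C}(Y,Y)$ for each cone. An $\ell^2$-cone is a cone $(g_j\colon Y\to X_j)_{j\in J}$ such that the net $(g_j^*g_j)_{j\in J}$ is bounded above. An $\ell^2$-limit is an $\ell^2$-cone $(f_j\colon X\to X_j)_{j\in J}$ such that for all $\ell^2$-cones $(g_j\colon Y\to X_j)_{j\in J}$ there is a unique morphism $g\colon Y\to X$ with $f_jg=g_j$ for all $j$, and this $g$ satisfies $g^*g=\sup_{j\in J}g_j^*g_j$ (in particular this supremum exists). A Hilbert $*$-category is a pre-Hilbert $*$-category that has $\ell^2$-limits of all codirected diagrams of contractions. *)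

theory Defs
  imports Main
begin

section \<open>Star-categories\<close>

text \<open>
  Arrows are single-sorted: every arrow carries its source and target, so hom-sets are disjoint.
  The composite \<open>comp C g f\<close> is only meaningful when the target of \<open>f\<close> is the source of \<open>g\<close>.
\<close>

record ('o, 'm) star_cat =
  Ob :: "'o set"
  Ar :: "'m set"
  src :: "'m \<Rightarrow> 'o"
  tgt :: "'m \<Rightarrow> 'o"
  ident :: "'o \<Rightarrow> 'm"
  comp :: "'m \<Rightarrow> 'm \<Rightarrow> 'm" (infixl \<open>\<cdot>\<index>\<close> 70)
  star :: "'m \<Rightarrow> 'm" (\<open>_\<^sup>\<dagger>\<index>\<close> [1000] 999)

definition hom :: "('o, 'm, 'z) star_cat_scheme \<Rightarrow> 'o \<Rightarrow> 'o \<Rightarrow> 'm set" where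
  "hom C X Y = {f \<in> Ar C. src C f = X \<and> tgt C f = Y}"

locale star_category =
  fixes C :: "('o, 'm, 'z) star_cat_scheme" (structure)
  assumes src_closed: "f \<in> Ar C \<Longrightarrow> src C f \<in> Ob C"
    and tgt_closed: "f \<in> Ar C \<Longrightarrow> tgt C f \<in> Ob C"
    and ident_closed: "X \<in> Ob C \<Longrightarrow> ident C X \<in> hom C X X"
    and comp_closed: "f \<in> hom C X Y \<Longrightarrow> g \<in> hom C Y Z \<Longrightarrow> g \<cdot> f \<in> hom C X Z"
    and ident_right: "f \<in> hom C X Y \<Longrightarrow> f \<cdot> ident C X = f"
    and ident_left: "f \<in> hom C X Y \<Longrightarrow> ident C Y \<cdot> f = f"
    and comp_assoc: "f \<in> hom C W X \<Longrightarrow> g \<in> hom C X Y \<Longrightarrow> h \<in> hom C Y Z \<Longrightarrow>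
          (h \<cdot> g) \<cdot> f = h \<cdot> (g \<cdot> f)"
    and star_closed: "f \<in> hom C X Y \<Longrightarrow> f\<^sup>\<dagger> \<in> hom C Y X"
    and star_ident: "X \<in> Ob C \<Longrightarrow> (ident C X)\<^sup>\<dagger> = ident C X"
    and star_comp: "f \<in> hom C X Y \<Longrightarrow> g \<in> hom C Y Z \<Longrightarrow> (g \<cdot> f)\<^sup>\<dagger> = f\<^sup>\<dagger> \<cdot> g\<^sup>\<dagger>"
    and star_star: "f \<in> hom C X Y \<Longrightarrow> (f\<^sup>\<dagger>)\<^sup>\<dagger> = f"

definition isometry :: "('o, 'm, 'z) star_cat_scheme \<Rightarrow> 'm \<Rightarrow> bool" where
  "isometry C f \<longleftrightarrow> f \<in> Ar C \<and> f\<^sup>\<dagger>\<^bsub>C\<^esub> \<cdot>\<^bsub>C\<^esub> f = ident C (src C f)"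

definition coisometry :: "('o, 'm, 'z) star_cat_scheme \<Rightarrow> 'm \<Rightarrow> bool" where
  "coisometry C f \<longleftrightarrow> f \<in> Ar C \<and> f \<cdot>\<^bsub>C\<^esub> f\<^sup>\<dagger>\<^bsub>C\<^esub> = ident C (tgt C f)"

definition zero_object :: "('o, 'm, 'z) star_cat_scheme \<Rightarrow> 'o \<Rightarrow> bool" where
  "zero_object C Z \<longleftrightarrow>
     Z \<in> Ob C \<and> (\<forall>X\<in>Ob C. (\<exists>!f. f \<in> hom C X Z) \<and> (\<exists>!f. f \<in> hom C Z X))"

definition zero_arrow :: "('o, 'm, 'z) star_cat_scheme \<Rightarrow> 'm \<Rightarrow> bool" where
  "zero_arrow C f \<longleftrightarrow> f \<in> Ar C \<and>
     (\<exists>Z g h. zero_object C Z \<and> g \<in> hom C (src C f) Z \<and> h \<in> hom C Z (tgt C f) \<and>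
        f = h \<cdot>\<^bsub>C\<^esub> g)"

definition binary_product ::
    "('o, 'm, 'z) star_cat_scheme \<Rightarrow> 'o \<Rightarrow> 'o \<Rightarrow> 'o \<Rightarrow> 'm \<Rightarrow> 'm \<Rightarrow> bool" where
  "binary_product C X1 X2 P r1 r2 \<longleftrightarrow>
     r1 \<in> hom C P X1 \<and> r2 \<in> hom C P X2 \<and>
     (\<forall>Y f1 f2. f1 \<in> hom C Y X1 \<longrightarrow> f2 \<in> hom C Y X2 \<longrightarrow>
        (\<exists>!f. f \<in> hom C Y P \<and> r1 \<cdot>\<^bsub>C\<^esub> f = f1 \<and> r2 \<cdot>\<^bsub>C\<^esub> f = f2))"

definition orthonormal_product ::
    "('o, 'm, 'z) star_cat_scheme \<Rightarrow> 'o \<Rightarrow> 'o \<Rightarrow> 'o \<Rightarrow> 'm \<Rightarrow> 'm \<Rightarrow> bool" where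
  "orthonormal_product C X1 X2 P r1 r2 \<longleftrightarrow>
     binary_product C X1 X2 P r1 r2 \<and> coisometry C r1 \<and> coisometry C r2 \<and>
     zero_arrow C (r1 \<cdot>\<^bsub>C\<^esub> r2\<^sup>\<dagger>\<^bsub>C\<^esub>)"

definition is_kernel :: "('o, 'm, 'z) star_cat_scheme \<Rightarrow> 'm \<Rightarrow> 'm \<Rightarrow> bool" where
  "is_kernel C f k \<longleftrightarrow>
     f \<in> Ar C \<and> k \<in> Ar C \<and> tgt C k = src C f \<and> zero_arrow C (f \<cdot>\<^bsub>C\<^esub> k) \<and>
     (\<forall>g\<in>Ar C. tgt C g = src C f \<longrightarrow> zero_arrow C (f \<cdot>\<^bsub>C\<^esub> g) \<longrightarrow>
        (\<exists>!u. u \<in> hom C (src C g) (src C k) \<and> k \<cdot>\<^bsub>C\<^esub> u = g))"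

definition is_diagonal ::
    "('o, 'm, 'z) star_cat_scheme \<Rightarrow> 'o \<Rightarrow> 'o \<Rightarrow> 'm \<Rightarrow> 'm \<Rightarrow> 'm \<Rightarrow> bool" where
  "is_diagonal C X P r1 r2 d \<longleftrightarrow>
     d \<in> hom C X P \<and> r1 \<cdot>\<^bsub>C\<^esub> d = ident C X \<and> r2 \<cdot>\<^bsub>C\<^esub> d = ident C X"

locale pre_hilbert_star_category = star_category C
  for C :: "('o, 'm, 'z) star_cat_scheme" (structure) +
  assumes ex_zero_object: "\<exists>Z. zero_object C Z"
    and ex_orthonormal_product:
      "X1 \<in> Ob C \<Longrightarrow> X2 \<in> Ob C \<Longrightarrow> \<exists>P r1 r2. orthonormal_product C X1 X2 P r1 r2"
    and ex_isometric_kernel: "f \<in> Ar C \<Longrightarrow> \<exists>k. is_kernel C f k \<and> isometry C k"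
    and diagonal_kernel:
      "X \<in> Ob C \<Longrightarrow> orthonormal_product C X X P r1 r2 \<Longrightarrow> is_diagonal C X P r1 r2 d \<Longrightarrow>
         \<exists>m. is_kernel C m d"

section \<open>The canonical addition and the order on Hermitian elements\<close>

text \<open>
  In a pre-Hilbert star-category, an orthonormal product \<open>(r1, r2)\<close> of \<open>Y\<close> with itself is a
  biproduct with injections \<open>r1\<^sup>\<dagger>\<close> and \<open>r2\<^sup>\<dagger>\<close>, so the codiagonal is \<open>d\<^sup>\<dagger>\<close>, where \<open>d\<close>
  is the diagonal. The sum of \<open>f, g : X \<rightarrow> Y\<close> in the canonical enrichment is therefore the
  composite of \<open>p = (f, g) : X \<rightarrow> Y \<oplus> Y\<close> with \<open>d\<^sup>\<dagger>\<close>. Orthonormal products are unique up to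
  unique unitary isomorphism, so this does not depend on the choice of product, and the definite
  description is well-defined. So is the one in the definition of the difference, because the
  canonical addition makes each hom-set an abelian group.
\<close>

definition add :: "('o, 'm, 'z) star_cat_scheme \<Rightarrow> 'm \<Rightarrow> 'm \<Rightarrow> 'm" where
  "add C f g = (THE s. \<exists>P r1 r2 p d.
     orthonormal_product C (tgt C f) (tgt C f) P r1 r2 \<and>
     p \<in> hom C (src C f) P \<and> r1 \<cdot>\<^bsub>C\<^esub> p = f \<and> r2 \<cdot>\<^bsub>C\<^esub> p = g \<and>
     is_diagonal C (tgt C f) P r1 r2 d \<and>
     s = d\<^sup>\<dagger>\<^bsub>C\<^esub> \<cdot>\<^bsub>C\<^esub> p)"

definition diff :: "('o, 'm, 'z) star_cat_scheme \<Rightarrow> 'm \<Rightarrow> 'm \<Rightarrow> 'm" where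
  "diff C g f = (THE e. e \<in> hom C (src C g) (tgt C g) \<and> add C e f = g)"

definition Herm :: "('o, 'm, 'z) star_cat_scheme \<Rightarrow> 'o \<Rightarrow> 'm set" where
  "Herm C A = {a \<in> hom C A A. a\<^sup>\<dagger>\<^bsub>C\<^esub> = a}"

definition herm_le :: "('o, 'm, 'z) star_cat_scheme \<Rightarrow> 'o \<Rightarrow> 'm \<Rightarrow> 'm \<Rightarrow> bool" where
  "herm_le C A f g \<longleftrightarrow> f \<in> Herm C A \<and> g \<in> Herm C A \<and>
     (\<exists>X h. h \<in> hom C A X \<and> diff C g f = h\<^sup>\<dagger>\<^bsub>C\<^esub> \<cdot>\<^bsub>C\<^esub> h)"

definition contraction :: "('o, 'm, 'z) star_cat_scheme \<Rightarrow> 'm \<Rightarrow> bool" where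
  "contraction C f \<longleftrightarrow> f \<in> Ar C \<and>
     herm_le C (src C f) (f\<^sup>\<dagger>\<^bsub>C\<^esub> \<cdot>\<^bsub>C\<^esub> f) (ident C (src C f))"

section \<open>Nets\<close>

text \<open>A directed set is a set \<open>J\<close> with a relation \<open>r\<close>, where \<open>(j, k) \<in> r\<close> means \<open>j \<le> k\<close>.\<close>

definition directed_set :: "'j set \<Rightarrow> ('j \<times> 'j) set \<Rightarrow> bool" where
  "directed_set J r \<longleftrightarrow>
     J \<noteq> {} \<and> preorder_on J r \<and> (\<forall>j\<in>J. \<forall>k\<in>J. \<exists>l\<in>J. (j, l) \<in> r \<and> (k, l) \<in> r)"

definition increasing_net ::
    "('o, 'm, 'z) star_cat_scheme \<Rightarrow> 'o \<Rightarrow> 'j set \<Rightarrow> ('j \<times> 'j) set \<Rightarrow> ('j \<Rightarrow> 'm) \<Rightarrow> bool" where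
  "increasing_net C A J r a \<longleftrightarrow>
     directed_set J r \<and> (\<forall>j\<in>J. a j \<in> Herm C A) \<and>
     (\<forall>j\<in>J. \<forall>k\<in>J. (j, k) \<in> r \<longrightarrow> herm_le C A (a j) (a k))"

definition upper_bound ::
    "('o, 'm, 'z) star_cat_scheme \<Rightarrow> 'o \<Rightarrow> 'j set \<Rightarrow> ('j \<Rightarrow> 'm) \<Rightarrow> 'm \<Rightarrow> bool" where
  "upper_bound C A J a b \<longleftrightarrow> b \<in> Herm C A \<and> (\<forall>j\<in>J. herm_le C A (a j) b)"

definition is_supremum ::
    "('o, 'm, 'z) star_cat_scheme \<Rightarrow> 'o \<Rightarrow> 'j set \<Rightarrow> ('j \<Rightarrow> 'm) \<Rightarrow> 'm \<Rightarrow> bool" where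
  "is_supremum C A J a s \<longleftrightarrow>
     upper_bound C A J a s \<and> (\<forall>b. upper_bound C A J a b \<longrightarrow> herm_le C A s b)"

section \<open>Square-summable limits of codirected diagrams of contractions\<close>

definition codirected_diagram ::
    "('o, 'm, 'z) star_cat_scheme \<Rightarrow> 'j set \<Rightarrow> ('j \<times> 'j) set \<Rightarrow> ('j \<Rightarrow> 'o) \<Rightarrow>
       ('j \<Rightarrow> 'j \<Rightarrow> 'm) \<Rightarrow> bool" where
  "codirected_diagram C J r X f \<longleftrightarrow>
     directed_set J r \<and> (\<forall>j\<in>J. X j \<in> Ob C) \<and>
     (\<forall>j\<in>J. \<forall>k\<in>J. (j, k) \<in> r \<longrightarrow> f j k \<in> hom C (X k) (X j)) \<and>
     (\<forall>j\<in>J. f j j = ident C (X j)) \<and>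
     (\<forall>j\<in>J. \<forall>k\<in>J. \<forall>l\<in>J. (j, k) \<in> r \<longrightarrow> (k, l) \<in> r \<longrightarrow> f j k \<cdot>\<^bsub>C\<^esub> f k l = f j l)"

definition diagram_of_contractions ::
    "('o, 'm, 'z) star_cat_scheme \<Rightarrow> 'j set \<Rightarrow> ('j \<times> 'j) set \<Rightarrow> ('j \<Rightarrow> 'o) \<Rightarrow>
       ('j \<Rightarrow> 'j \<Rightarrow> 'm) \<Rightarrow> bool" where
  "diagram_of_contractions C J r X f \<longleftrightarrow>
     codirected_diagram C J r X f \<and>
     (\<forall>j\<in>J. \<forall>k\<in>J. (j, k) \<in> r \<longrightarrow> contraction C (f j k))"

definition cone ::
    "('o, 'm, 'z) star_cat_scheme \<Rightarrow> 'j set \<Rightarrow> ('j \<times> 'j) set \<Rightarrow> ('j \<Rightarrow> 'o) \<Rightarrow>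
       ('j \<Rightarrow> 'j \<Rightarrow> 'm) \<Rightarrow> 'o \<Rightarrow> ('j \<Rightarrow> 'm) \<Rightarrow> bool" where
  "cone C J r X f Y g \<longleftrightarrow>
     Y \<in> Ob C \<and> (\<forall>j\<in>J. g j \<in> hom C Y (X j)) \<and>
     (\<forall>j\<in>J. \<forall>k\<in>J. (j, k) \<in> r \<longrightarrow> f j k \<cdot>\<^bsub>C\<^esub> g k = g j)"

definition l2_cone ::
    "('o, 'm, 'z) star_cat_scheme \<Rightarrow> 'j set \<Rightarrow> ('j \<times> 'j) set \<Rightarrow> ('j \<Rightarrow> 'o) \<Rightarrow>
       ('j \<Rightarrow> 'j \<Rightarrow> 'm) \<Rightarrow> 'o \<Rightarrow> ('j \<Rightarrow> 'm) \<Rightarrow> bool" where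
  "l2_cone C J r X f Y g \<longleftrightarrow>
     cone C J r X f Y g \<and> (\<exists>b. upper_bound C Y J (\<lambda>j. (g j)\<^sup>\<dagger>\<^bsub>C\<^esub> \<cdot>\<^bsub>C\<^esub> g j) b)"

definition l2_limit ::
    "('o, 'm, 'z) star_cat_scheme \<Rightarrow> 'j set \<Rightarrow> ('j \<times> 'j) set \<Rightarrow> ('j \<Rightarrow> 'o) \<Rightarrow>
       ('j \<Rightarrow> 'j \<Rightarrow> 'm) \<Rightarrow> 'o \<Rightarrow> ('j \<Rightarrow> 'm) \<Rightarrow> bool" where
  "l2_limit C J r X f L p \<longleftrightarrow>
     l2_cone C J r X f L p \<and>
     (\<forall>Y g. l2_cone C J r X f Y g \<longrightarrow>
        (\<exists>!u. u \<in> hom C Y L \<and> (\<forall>j\<in>J. p j \<cdot>\<^bsub>C\<^esub> u = g j)) \<and>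
        (\<forall>u. u \<in> hom C Y L \<and> (\<forall>j\<in>J. p j \<cdot>\<^bsub>C\<^esub> u = g j) \<longrightarrow>
           is_supremum C Y J (\<lambda>j. (g j)\<^sup>\<dagger>\<^bsub>C\<^esub> \<cdot>\<^bsub>C\<^esub> g j) (u\<^sup>\<dagger>\<^bsub>C\<^esub> \<cdot>\<^bsub>C\<^esub> u)))"

text \<open>
  A formula cannot quantify over types, so ``all'' directed sets means all directed sets whose
  elements belong to an arbitrary type \<open>'j\<close>, which plays the role of the universe of small sets.
\<close>

definition hilbert_star_category :: "('o, 'm, 'z) star_cat_scheme \<Rightarrow> 'j itself \<Rightarrow> bool" where
  "hilbert_star_category C index_universe \<longleftrightarrow>
     pre_hilbert_star_category C \<and>
     (\<forall>(J :: 'j set) r X f.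
        diagram_of_contractions C J r X f \<longrightarrow> (\<exists>L p. l2_limit C J r X f L p))"

definition monotone_complete :: "('o, 'm, 'z) star_cat_scheme \<Rightarrow> 'j itself \<Rightarrow> bool" where
  "monotone_complete C index_universe \<longleftrightarrow>
     (\<forall>A\<in>Ob C. \<forall>(J :: 'j set) r a.
        increasing_net C A J r a \<longrightarrow> (\<exists>b. upper_bound C A J a b) \<longrightarrow>
        (\<exists>s. is_supremum C A J a s))"

end

theory Submission
  imports Defs
begin

text \<open>
  Call \<open>h\<^sup>\<dagger> h\<close> the Gram arrow of \<open>h\<close>. An \<open>\<ell>\<^sup>2\<close>-limit produces the supremum of the Gram arrows of an
  \<open>\<ell>\<^sup>2\<close>-cone, so the task is to realise an increasing net as the Gram arrows of a cone on a diagram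
  of contractions. If the given net consists of the Gram arrows of isomorphisms \<open>v j : A \<rightarrow> X j\<close>,
  this is immediate: the arrows \<open>v j (v k)\<^sup>-\<^sup>1 : X k \<rightarrow> X j\<close> form a codirected diagram on which
  \<open>v\<close> is a cone, and conjugating \<open>(v j)\<^sup>\<dagger> (v j) \<le> (v k)\<^sup>\<dagger> (v k)\<close> by \<open>(v k)\<^sup>-\<^sup>1\<close> shows that they are
  contractions (\<open>gram_net_has_supremum\<close>).

  The general case reduces to this one by passing to the tail of the net above an index \<open>j0\<close> and
  adding \<open>1 - a j0\<close>, which changes neither order relations nor the existence of a supremum. The
  new values are of the form \<open>1 + h\<^sup>\<dagger> h\<close>, the Gram arrow of the graph \<open>(1, h)\<close>. A graph is a kernel,
  and every kernel is an isometry composed with an isomorphism, so \<open>1 + h\<^sup>\<dagger> h\<close> is the Gram arrow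
  of an isomorphism (\<open>ident_plus_gram_factor\<close>).

  Both steps need hom-sets to be abelian groups with biadditive composition. Commutative monoids
  come from the biproduct structure of orthonormal products. Cancellation and additive inverses
  (\<open>add_right_cancel\<close>, \<open>minus_ident_exists\<close>) come from the diagonal being a kernel.
\<close>

section \<open>Arrows of a star-category\<close>

context star_category
begin

lemma in_hom: "f \<in> hom C X Y \<longleftrightarrow> f \<in> Ar C \<and> src C f = X \<and> tgt C f = Y"
  by (simp add: hom_def)

lemma arrow_in_hom: "f \<in> Ar C \<Longrightarrow> f \<in> hom C (src C f) (tgt C f)"
  by (simp add: in_hom)

lemma hom_Ob: "f \<in> hom C X Y \<Longrightarrow> X \<in> Ob C" "f \<in> hom C X Y \<Longrightarrow> Y \<in> Ob C"
  using src_closed tgt_closed by (auto simp: in_hom)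

lemma comp_typing [simp]:
  assumes "f \<in> Ar C" "g \<in> Ar C" "src C g = tgt C f"
  shows "g \<cdot> f \<in> Ar C" "src C (g \<cdot> f) = src C f" "tgt C (g \<cdot> f) = tgt C g"
  using comp_closed[of f "src C f" "tgt C f" g "tgt C g"] assms by (auto simp: in_hom)

lemma star_typing [simp]:
  assumes "f \<in> Ar C"
  shows "f\<^sup>\<dagger> \<in> Ar C" "src C (f\<^sup>\<dagger>) = tgt C f" "tgt C (f\<^sup>\<dagger>) = src C f"
  using star_closed[OF arrow_in_hom] assms by (auto simp: in_hom)

lemma ident_typing [simp]:
  assumes "X \<in> Ob C"
  shows "ident C X \<in> Ar C" "src C (ident C X) = X" "tgt C (ident C X) = X"
  using ident_closed assms by (auto simp: in_hom)

lemma comp_ident [simp]: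
  assumes "f \<in> Ar C"
  shows "src C f = X \<Longrightarrow> f \<cdot> ident C X = f" "tgt C f = Y \<Longrightarrow> ident C Y \<cdot> f = f"
  using ident_left ident_right arrow_in_hom[OF assms] by auto

lemma star_star_arrow [simp]: "f \<in> Ar C \<Longrightarrow> (f\<^sup>\<dagger>)\<^sup>\<dagger> = f"
  using star_star arrow_in_hom by blast

lemma star_comp_arrow [simp]:
  assumes "f \<in> Ar C" "g \<in> Ar C" "src C g = tgt C f"
  shows "(g \<cdot> f)\<^sup>\<dagger> = f\<^sup>\<dagger> \<cdot> g\<^sup>\<dagger>"
  using star_comp[of f "src C f" "tgt C f" g "tgt C g"] assms by (auto simp: in_hom)

lemma comp_assoc_arrow [simp]:
  assumes "f \<in> Ar C" "g \<in> Ar C" "h \<in> Ar C" "src C g = tgt C f" "src C h = tgt C g"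
  shows "h \<cdot> g \<cdot> f = h \<cdot> (g \<cdot> f)"
  using comp_assoc[of f "src C f" "tgt C f" g "tgt C g" h "tgt C h"] assms by (auto simp: in_hom)

declare star_ident [simp] src_closed [simp] tgt_closed [simp]

text \<open>The form in which an equation between composites is used inside a right-nested composite.\<close>

lemma comp_cancel:
  assumes "g \<cdot> f = h" "f \<in> Ar C" "g \<in> Ar C" "x \<in> Ar C" "src C g = tgt C f" "src C f = tgt C x"
  shows "g \<cdot> (f \<cdot> x) = h \<cdot> x"
  using assms comp_assoc_arrow[of x f g] by simp

end

section \<open>Zero arrows and orthonormal products\<close>

context pre_hilbert_star_category
begin

text \<open>The zero arrow between two given objects, independent of the zero object chosen.\<close>

definition zero :: "'o \<Rightarrow> 'o \<Rightarrow> 'm" where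
  "zero X Y = (THE f. f \<in> hom C X Y \<and> zero_arrow C f)"

lemma zero_objectD:
  assumes "zero_object C Z" "X \<in> Ob C"
  shows "\<exists>f. f \<in> hom C X Z" "\<exists>f. f \<in> hom C Z X"
    and "f \<in> hom C X Z \<Longrightarrow> g \<in> hom C X Z \<Longrightarrow> f = g"
    and "f \<in> hom C Z X \<Longrightarrow> g \<in> hom C Z X \<Longrightarrow> f = g"
proof -
  have "(\<exists>!f. f \<in> hom C X Z) \<and> (\<exists>!f. f \<in> hom C Z X)"
    using assms by (simp only: zero_object_def)
  then show "\<exists>f. f \<in> hom C X Z" "\<exists>f. f \<in> hom C Z X"
    and "f \<in> hom C X Z \<Longrightarrow> g \<in> hom C X Z \<Longrightarrow> f = g"
    and "f \<in> hom C Z X \<Longrightarrow> g \<in> hom C Z X \<Longrightarrow> f = g"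
    by auto
qed

lemma zero_arrow_ex1:
  assumes X: "X \<in> Ob C" and Y: "Y \<in> Ob C"
  shows "\<exists>!f. f \<in> hom C X Y \<and> zero_arrow C f"
proof -
  obtain Z where Z: "zero_object C Z"
    using ex_zero_object by blast
  obtain g h where g: "g \<in> hom C X Z" and h: "h \<in> hom C Z Y"
    using zero_objectD(1)[OF Z X] zero_objectD(2)[OF Z Y] by blast
  show ?thesis
  proof (rule ex1I)
    show "h \<cdot> g \<in> hom C X Y \<and> zero_arrow C (h \<cdot> g)"
      using Z g h unfolding zero_arrow_def by (auto simp: in_hom)
  next
    fix f assume "f \<in> hom C X Y \<and> zero_arrow C f"
    then obtain Z' g' h' where Z': "zero_object C Z'" and g': "g' \<in> hom C X Z'"
      and h': "h' \<in> hom C Z' Y" and eq: "f = h' \<cdot> g'"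
      unfolding zero_arrow_def by (auto simp: in_hom)
    have "Z' \<in> Ob C"
      using Z' by (simp add: zero_object_def)
    then obtain t where t: "t \<in> hom C Z Z'"
      using zero_objectD(2)[OF Z] by blast
    have tg: "t \<cdot> g = g'"
      using zero_objectD(3)[OF Z' X] comp_closed[OF g t] g' by blast
    have ht: "h' \<cdot> t = h"
      using zero_objectD(4)[OF Z Y] comp_closed[OF t h'] h by blast
    show "f = h \<cdot> g"
      using comp_assoc[OF g t h'] by (simp only: eq tg ht)
  qed
qed

lemma zero_arrow_zero:
  assumes "X \<in> Ob C" "Y \<in> Ob C"
  shows "zero X Y \<in> hom C X Y" "zero_arrow C (zero X Y)"
  using theI'[OF zero_arrow_ex1[OF assms]] unfolding zero_def by auto

lemma zero_typing [simp]:
  assumes "X \<in> Ob C" "Y \<in> Ob C"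
  shows "zero X Y \<in> Ar C" "src C (zero X Y) = X" "tgt C (zero X Y) = Y"
  using zero_arrow_zero[OF assms] by (auto simp: in_hom)

lemma zero_arrow_iff:
  "zero_arrow C f \<longleftrightarrow> f \<in> Ar C \<and> f = zero (src C f) (tgt C f)"
proof
  assume f: "zero_arrow C f"
  then have "f \<in> Ar C"
    by (simp add: zero_arrow_def)
  then show "f \<in> Ar C \<and> f = zero (src C f) (tgt C f)"
    using f zero_arrow_ex1[of "src C f" "tgt C f"] zero_arrow_zero[of "src C f" "tgt C f"] arrow_in_hom
    by fastforce
next
  assume "f \<in> Ar C \<and> f = zero (src C f) (tgt C f)"
  then show "zero_arrow C f"
    using zero_arrow_zero(2)[of "src C f" "tgt C f"] by simp
qed

lemma zero_arrowI:
  assumes "zero_object C Z" "k \<in> Ar C" "tgt C k = Z" "l \<in> Ar C" "src C l = Z"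
  shows "zero_arrow C (l \<cdot> k)"
  using assms unfolding zero_arrow_def by (auto simp: in_hom)

lemma comp_zero_arrow:
  assumes f: "zero_arrow C f" and g: "g \<in> Ar C"
  shows "src C g = tgt C f \<Longrightarrow> zero_arrow C (g \<cdot> f)"
    and "src C f = tgt C g \<Longrightarrow> zero_arrow C (f \<cdot> g)"
    and "zero_arrow C (f\<^sup>\<dagger>)"
proof -
  obtain Z k l where Z: "zero_object C Z" and k: "k \<in> Ar C" "tgt C k = Z"
    and l: "l \<in> Ar C" "src C l = Z" and f_eq: "f = l \<cdot> k"
    using f unfolding zero_arrow_def by (auto simp: in_hom)
  show "zero_arrow C (g \<cdot> f)" if "src C g = tgt C f"
    using zero_arrowI[of Z k "g \<cdot> l"] Z k l g that f_eq by simp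
  show "zero_arrow C (f \<cdot> g)" if "src C f = tgt C g"
    using zero_arrowI[of Z "k \<cdot> g" l] Z k l g that f_eq by simp
  show "zero_arrow C (f\<^sup>\<dagger>)"
    using zero_arrowI[of Z "l\<^sup>\<dagger>" "k\<^sup>\<dagger>"] Z k l f_eq by simp
qed

lemma comp_zero [simp]:
  assumes "f \<in> Ar C" "X \<in> Ob C"
  shows "src C f = Y \<Longrightarrow> f \<cdot> zero X Y = zero X (tgt C f)"
    and "tgt C f = Y \<Longrightarrow> zero Y X \<cdot> f = zero (src C f) X"
  using comp_zero_arrow(1)[of "zero X (src C f)" f] comp_zero_arrow(2)[of "zero (tgt C f) X" f] assms
    zero_arrow_zero(2)
  by (auto simp: zero_arrow_iff)

lemma star_zero [simp]: "X \<in> Ob C \<Longrightarrow> Y \<in> Ob C \<Longrightarrow> (zero X Y)\<^sup>\<dagger> = zero Y X"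
  using comp_zero_arrow(3)[of "zero X Y" "zero X Y"] zero_arrow_zero(2)[of X Y]
  by (auto simp: zero_arrow_iff)

lemma orthonormal_productD:
  assumes "orthonormal_product C X Y P r1 r2"
  shows "r1 \<in> Ar C" "src C r1 = P" "tgt C r1 = X" "r2 \<in> Ar C" "src C r2 = P" "tgt C r2 = Y"
    and "X \<in> Ob C" "Y \<in> Ob C" "P \<in> Ob C"
    and "r1 \<cdot> r1\<^sup>\<dagger> = ident C X" "r2 \<cdot> r2\<^sup>\<dagger> = ident C Y"
    and "r1 \<cdot> r2\<^sup>\<dagger> = zero Y X" "r2 \<cdot> r1\<^sup>\<dagger> = zero X Y"
proof -
  show ty: "r1 \<in> Ar C" "src C r1 = P" "tgt C r1 = X" "r2 \<in> Ar C" "src C r2 = P" "tgt C r2 = Y"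
    using assms by (auto simp: orthonormal_product_def binary_product_def in_hom)
  then show ob: "X \<in> Ob C" "Y \<in> Ob C" "P \<in> Ob C"
    using src_closed tgt_closed by blast+
  show "r1 \<cdot> r1\<^sup>\<dagger> = ident C X" "r2 \<cdot> r2\<^sup>\<dagger> = ident C Y"
    using assms ty by (auto simp: orthonormal_product_def coisometry_def)
  show *: "r1 \<cdot> r2\<^sup>\<dagger> = zero Y X"
    using assms ty by (auto simp: orthonormal_product_def zero_arrow_iff)
  have "r2 \<cdot> r1\<^sup>\<dagger> = (r1 \<cdot> r2\<^sup>\<dagger>)\<^sup>\<dagger>"
    using ty by simp
  then show "r2 \<cdot> r1\<^sup>\<dagger> = zero X Y"
    using * ob by simp
qed

text \<open>The same equations inside a right-nested composite.\<close>

lemma orthonormal_product_cancel: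
  assumes P: "orthonormal_product C X Y P r1 r2" and "x \<in> Ar C"
  shows "tgt C x = X \<Longrightarrow> r1 \<cdot> (r1\<^sup>\<dagger> \<cdot> x) = x"
    and "tgt C x = Y \<Longrightarrow> r2 \<cdot> (r2\<^sup>\<dagger> \<cdot> x) = x"
    and "tgt C x = Y \<Longrightarrow> r1 \<cdot> (r2\<^sup>\<dagger> \<cdot> x) = zero (src C x) X"
    and "tgt C x = X \<Longrightarrow> r2 \<cdot> (r1\<^sup>\<dagger> \<cdot> x) = zero (src C x) Y"
  using orthonormal_productD[OF P] \<open>x \<in> Ar C\<close>
    comp_cancel[of r1 "r1\<^sup>\<dagger>" _ x] comp_cancel[of r2 "r2\<^sup>\<dagger>" _ x]
    comp_cancel[of r1 "r2\<^sup>\<dagger>" _ x] comp_cancel[of r2 "r1\<^sup>\<dagger>" _ x]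
  by auto

lemma pair_exists:
  assumes "orthonormal_product C X Y P r1 r2" "f \<in> hom C W X" "g \<in> hom C W Y"
  obtains p where "p \<in> Ar C" "src C p = W" "tgt C p = P" "r1 \<cdot> p = f" "r2 \<cdot> p = g"
proof -
  have "\<exists>!p. p \<in> hom C W P \<and> r1 \<cdot> p = f \<and> r2 \<cdot> p = g"
    using assms unfolding orthonormal_product_def binary_product_def by blast
  then show ?thesis
    using that by (auto simp: in_hom)
qed

lemma pair_unique:
  assumes P: "orthonormal_product C X Y P r1 r2" and p: "p \<in> hom C W P" and q: "q \<in> hom C W P"
    and eq: "r1 \<cdot> p = r1 \<cdot> q" "r2 \<cdot> p = r2 \<cdot> q"
  shows "p = q"
proof -
  have "r1 \<cdot> p \<in> hom C W X" "r2 \<cdot> p \<in> hom C W Y"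
    using orthonormal_productD[OF P] p by (auto simp: in_hom)
  then have "\<exists>!x. x \<in> hom C W P \<and> r1 \<cdot> x = r1 \<cdot> p \<and> r2 \<cdot> x = r2 \<cdot> p"
    using P unfolding orthonormal_product_def binary_product_def by blast
  then show ?thesis
    using p q eq by metis
qed

text \<open>
  Applying the involution, the adjoints of the projections are the injections of a coproduct.
\<close>

lemma copair_exists:
  assumes P: "orthonormal_product C X Y P r1 r2" and f: "f \<in> hom C X W" and g: "g \<in> hom C Y W"
  obtains c where "c \<in> Ar C" "src C c = P" "tgt C c = W" "c \<cdot> r1\<^sup>\<dagger> = f" "c \<cdot> r2\<^sup>\<dagger> = g"
proof -
  obtain p where p: "p \<in> Ar C" "src C p = W" "tgt C p = P" "r1 \<cdot> p = f\<^sup>\<dagger>" "r2 \<cdot> p = g\<^sup>\<dagger>"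
    using pair_exists[OF P] f g star_closed by metis
  have "p\<^sup>\<dagger> \<cdot> r1\<^sup>\<dagger> = (r1 \<cdot> p)\<^sup>\<dagger>" "p\<^sup>\<dagger> \<cdot> r2\<^sup>\<dagger> = (r2 \<cdot> p)\<^sup>\<dagger>"
    using orthonormal_productD[OF P] p(1-3) by simp_all
  then have "p\<^sup>\<dagger> \<cdot> r1\<^sup>\<dagger> = f" "p\<^sup>\<dagger> \<cdot> r2\<^sup>\<dagger> = g"
    using p f g by (simp_all add: in_hom)
  with p(1-3) show ?thesis
    by (intro that[of "p\<^sup>\<dagger>"]) auto
qed

lemma copair_unique:
  assumes P: "orthonormal_product C X Y P r1 r2" and c: "c \<in> hom C P W" and d: "d \<in> hom C P W"
    and eq: "c \<cdot> r1\<^sup>\<dagger> = d \<cdot> r1\<^sup>\<dagger>" "c \<cdot> r2\<^sup>\<dagger> = d \<cdot> r2\<^sup>\<dagger>"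
  shows "c = d"
proof -
  have *: "r1 \<cdot> c\<^sup>\<dagger> = (c \<cdot> r1\<^sup>\<dagger>)\<^sup>\<dagger>" "r2 \<cdot> c\<^sup>\<dagger> = (c \<cdot> r2\<^sup>\<dagger>)\<^sup>\<dagger>"
    "r1 \<cdot> d\<^sup>\<dagger> = (d \<cdot> r1\<^sup>\<dagger>)\<^sup>\<dagger>" "r2 \<cdot> d\<^sup>\<dagger> = (d \<cdot> r2\<^sup>\<dagger>)\<^sup>\<dagger>"
    using orthonormal_productD[OF P] c d by (simp_all add: in_hom)
  have "c\<^sup>\<dagger> = d\<^sup>\<dagger>"
    by (rule pair_unique[OF P star_closed[OF c] star_closed[OF d]]) (simp_all only: * eq)
  then show ?thesis
    using c d star_star by metis
qed

lemma orthonormal_product_swap: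
  assumes P: "orthonormal_product C X Y P r1 r2"
  shows "orthonormal_product C Y X P r2 r1"
proof -
  have "binary_product C Y X P r2 r1"
    using P unfolding orthonormal_product_def binary_product_def by (metis (no_types, lifting))
  moreover have "zero_arrow C (r2 \<cdot> r1\<^sup>\<dagger>)"
    using orthonormal_productD[OF P] zero_arrow_zero by simp
  ultimately show ?thesis
    using P by (simp add: orthonormal_product_def)
qed

section \<open>Addition of arrows\<close>

text \<open>
  The sum of the components of \<open>p\<close> is \<open>s p\<close>, where \<open>s\<close> is the codiagonal of whichever orthonormal
  product is used; in particular the definite description in the definition of the sum denotes.
\<close>

lemma add_eq_codiagonal:
  assumes P: "orthonormal_product C Y Y P r1 r2" and p: "p \<in> hom C X P" and s: "s \<in> hom C P Y"
    and s1: "s \<cdot> r1\<^sup>\<dagger> = ident C Y" and s2: "s \<cdot> r2\<^sup>\<dagger> = ident C Y"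
  shows "add C (r1 \<cdot> p) (r2 \<cdot> p) = s \<cdot> p"
proof -
  note r = orthonormal_productD[OF P]
  have pt: "p \<in> Ar C" "src C p = X" "tgt C p = P" and st: "s \<in> Ar C" "src C s = P" "tgt C s = Y"
    using p s by (auto simp: in_hom)
  let ?Q = "\<lambda>t. \<exists>P' t1 t2 p' d. orthonormal_product C Y Y P' t1 t2 \<and>
     p' \<in> hom C X P' \<and> t1 \<cdot> p' = r1 \<cdot> p \<and> t2 \<cdot> p' = r2 \<cdot> p \<and>
     is_diagonal C Y P' t1 t2 d \<and> t = d\<^sup>\<dagger> \<cdot> p'"
  have "r1 \<cdot> s\<^sup>\<dagger> = (s \<cdot> r1\<^sup>\<dagger>)\<^sup>\<dagger>" "r2 \<cdot> s\<^sup>\<dagger> = (s \<cdot> r2\<^sup>\<dagger>)\<^sup>\<dagger>"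
    using r st by simp_all
  then have diag: "is_diagonal C Y P r1 r2 (s\<^sup>\<dagger>)"
    using s1 s2 r st by (simp add: is_diagonal_def in_hom)
  have ex: "?Q (s \<cdot> p)"
    using P p diag st by (intro exI[of _ P] exI[of _ r1] exI[of _ r2] exI[of _ p] exI[of _ "s\<^sup>\<dagger>"]) simp
  have un: "t = s \<cdot> p" if Qt: "?Q t" for t
  proof -
    obtain P' t1 t2 p' d where P': "orthonormal_product C Y Y P' t1 t2" and p': "p' \<in> hom C X P'"
      and eq: "t1 \<cdot> p' = r1 \<cdot> p" "t2 \<cdot> p' = r2 \<cdot> p" and d: "is_diagonal C Y P' t1 t2 d"
      and t: "t = d\<^sup>\<dagger> \<cdot> p'"
      using Qt by blast
    note r' = orthonormal_productD[OF P']
    have pt': "p' \<in> Ar C" "src C p' = X" "tgt C p' = P'"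
      using p' by (auto simp: in_hom)
    have dt: "d \<in> Ar C" "src C d = Y" "tgt C d = P'" "t1 \<cdot> d = ident C Y" "t2 \<cdot> d = ident C Y"
      using d by (auto simp: is_diagonal_def in_hom)
    \<comment> \<open>The comparison of the two products preserves the injections too, hence the codiagonals.\<close>
    obtain u where u: "u \<in> Ar C" "src C u = P" "tgt C u = P'" "t1 \<cdot> u = r1" "t2 \<cdot> u = r2"
      using pair_exists[OF P'] r by (metis in_hom)
    have up: "u \<cdot> p = p'"
      by (rule pair_unique[OF P', of _ X])
        (use u pt pt' eq r r' comp_cancel[OF u(4), of p] comp_cancel[OF u(5), of p] in
          \<open>simp_all add: in_hom\<close>)
    have u1: "u \<cdot> r1\<^sup>\<dagger> = t1\<^sup>\<dagger>"
      by (rule pair_unique[OF P', of _ Y])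
        (use u r r' comp_cancel[OF u(4), of "r1\<^sup>\<dagger>"] comp_cancel[OF u(5), of "r1\<^sup>\<dagger>"] in
          \<open>simp_all add: in_hom\<close>)
    have u2: "u \<cdot> r2\<^sup>\<dagger> = t2\<^sup>\<dagger>"
      by (rule pair_unique[OF P', of _ Y])
        (use u r r' comp_cancel[OF u(4), of "r2\<^sup>\<dagger>"] comp_cancel[OF u(5), of "r2\<^sup>\<dagger>"] in
          \<open>simp_all add: in_hom\<close>)
    have "d\<^sup>\<dagger> \<cdot> t1\<^sup>\<dagger> = (t1 \<cdot> d)\<^sup>\<dagger>" "d\<^sup>\<dagger> \<cdot> t2\<^sup>\<dagger> = (t2 \<cdot> d)\<^sup>\<dagger>"
      using dt(1-3) r' by simp_all
    then have ds: "d\<^sup>\<dagger> \<cdot> t1\<^sup>\<dagger> = ident C Y" "d\<^sup>\<dagger> \<cdot> t2\<^sup>\<dagger> = ident C Y"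
      by (simp_all only: dt(4,5) star_ident[OF r(7)])
    have "d\<^sup>\<dagger> \<cdot> u = s"
      by (rule copair_unique[OF P, of _ Y])
        (use ds u u1 u2 dt st s1 s2 r r' in \<open>simp_all add: in_hom\<close>)
    then show ?thesis
      using t up u(1-3) dt(1-3) pt comp_cancel[of "d\<^sup>\<dagger>" u s p] by simp
  qed
  have "(THE t. ?Q t) = s \<cdot> p"
    by (rule the_equality[of ?Q, OF ex un])
  then show ?thesis
    using r pt by (simp add: add_def)
qed

lemma codiagonal_exists:
  assumes "Y \<in> Ob C"
  obtains P r1 r2 s where "orthonormal_product C Y Y P r1 r2" "s \<in> Ar C" "src C s = P" "tgt C s = Y"
    "s \<cdot> r1\<^sup>\<dagger> = ident C Y" "s \<cdot> r2\<^sup>\<dagger> = ident C Y"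
  using ex_orthonormal_product[OF assms assms] copair_exists ident_closed[OF assms] by metis

text \<open>Composition through an orthonormal product is the product of a row and a column.\<close>

lemma row_comp_column:
  assumes P: "orthonormal_product C X Y P r1 r2" and p: "p \<in> hom C W P" and c: "c \<in> hom C P Z"
  shows "c \<cdot> p = add C ((c \<cdot> r1\<^sup>\<dagger>) \<cdot> (r1 \<cdot> p)) ((c \<cdot> r2\<^sup>\<dagger>) \<cdot> (r2 \<cdot> p))"
proof -
  note r = orthonormal_productD[OF P]
  have pt: "p \<in> Ar C" "src C p = W" "tgt C p = P" and ct: "c \<in> Ar C" "src C c = P" "tgt C c = Z"
    using p c by (auto simp: in_hom)
  have "Z \<in> Ob C"
    using ct tgt_closed by blast
  then obtain Q q1 q2 s where Q: "orthonormal_product C Z Z Q q1 q2"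
    and s: "s \<in> Ar C" "src C s = Q" "tgt C s = Z" "s \<cdot> q1\<^sup>\<dagger> = ident C Z" "s \<cdot> q2\<^sup>\<dagger> = ident C Z"
    using codiagonal_exists by metis
  note q = orthonormal_productD[OF Q]
  have "c \<cdot> r1\<^sup>\<dagger> \<cdot> r1 \<in> hom C P Z" "c \<cdot> r2\<^sup>\<dagger> \<cdot> r2 \<in> hom C P Z"
    using ct r by (auto simp: in_hom)
  then obtain m where m: "m \<in> Ar C" "src C m = P" "tgt C m = Q"
    "q1 \<cdot> m = c \<cdot> r1\<^sup>\<dagger> \<cdot> r1" "q2 \<cdot> m = c \<cdot> r2\<^sup>\<dagger> \<cdot> r2"
    using pair_exists[OF Q] by metis
  have "m \<cdot> r1\<^sup>\<dagger> = q1\<^sup>\<dagger> \<cdot> (c \<cdot> r1\<^sup>\<dagger>)"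
    by (rule pair_unique[OF Q, of _ X])
      (use m ct r q orthonormal_product_cancel[OF Q, of "c \<cdot> r1\<^sup>\<dagger>"]
        comp_cancel[OF m(4), of "r1\<^sup>\<dagger>"] comp_cancel[OF m(5), of "r1\<^sup>\<dagger>"] in \<open>simp_all add: in_hom\<close>)
  then have 1: "s \<cdot> m \<cdot> r1\<^sup>\<dagger> = c \<cdot> r1\<^sup>\<dagger>"
    using m s q ct r comp_cancel[OF s(4), of "c \<cdot> r1\<^sup>\<dagger>"] by simp
  have "m \<cdot> r2\<^sup>\<dagger> = q2\<^sup>\<dagger> \<cdot> (c \<cdot> r2\<^sup>\<dagger>)"
    by (rule pair_unique[OF Q, of _ Y])
      (use m ct r q orthonormal_product_cancel[OF Q, of "c \<cdot> r2\<^sup>\<dagger>"]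
        comp_cancel[OF m(4), of "r2\<^sup>\<dagger>"] comp_cancel[OF m(5), of "r2\<^sup>\<dagger>"] in \<open>simp_all add: in_hom\<close>)
  then have 2: "s \<cdot> m \<cdot> r2\<^sup>\<dagger> = c \<cdot> r2\<^sup>\<dagger>"
    using m s q ct r comp_cancel[OF s(5), of "c \<cdot> r2\<^sup>\<dagger>"] by simp
  have sm: "s \<cdot> m = c"
    by (rule copair_unique[OF P, of _ Z]) (use 1 2 m s ct in \<open>simp_all add: in_hom\<close>)
  have "add C (q1 \<cdot> (m \<cdot> p)) (q2 \<cdot> (m \<cdot> p)) = s \<cdot> (m \<cdot> p)"
    by (rule add_eq_codiagonal[OF Q, of _ W]) (use m s pt in \<open>simp_all add: in_hom\<close>)
  then show ?thesis
    using m s pt q r ct comp_cancel[OF sm, of p] comp_cancel[OF m(4), of p] comp_cancel[OF m(5), of p]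
    by simp
qed

abbreviation plus :: "'m \<Rightarrow> 'm \<Rightarrow> 'm" (infixl \<open>\<oplus>\<close> 65) where
  "f \<oplus> g \<equiv> add C f g"

lemma add_as_codiagonal:
  assumes f: "f \<in> hom C X Y" and g: "g \<in> hom C X Y"
  obtains P r1 r2 s p where "orthonormal_product C Y Y P r1 r2"
    "s \<in> Ar C" "src C s = P" "tgt C s = Y" "s \<cdot> r1\<^sup>\<dagger> = ident C Y" "s \<cdot> r2\<^sup>\<dagger> = ident C Y"
    "p \<in> Ar C" "src C p = X" "tgt C p = P" "r1 \<cdot> p = f" "r2 \<cdot> p = g" "f \<oplus> g = s \<cdot> p"
proof -
  obtain P r1 r2 s where P: "orthonormal_product C Y Y P r1 r2"
    and s: "s \<in> Ar C" "src C s = P" "tgt C s = Y" "s \<cdot> r1\<^sup>\<dagger> = ident C Y" "s \<cdot> r2\<^sup>\<dagger> = ident C Y"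
    using codiagonal_exists[OF hom_Ob(2)[OF f]] by blast
  obtain p where p: "p \<in> Ar C" "src C p = X" "tgt C p = P" "r1 \<cdot> p = f" "r2 \<cdot> p = g"
    using pair_exists[OF P f g] by blast
  have "r1 \<cdot> p \<oplus> r2 \<cdot> p = s \<cdot> p"
    by (rule add_eq_codiagonal[OF P]) (use p s in \<open>simp_all add: in_hom\<close>)
  then have "f \<oplus> g = s \<cdot> p"
    by (simp only: p)
  with P s p show ?thesis
    by (rule that)
qed

lemma add_closed: "f \<in> hom C X Y \<Longrightarrow> g \<in> hom C X Y \<Longrightarrow> f \<oplus> g \<in> hom C X Y"
  by (erule (1) add_as_codiagonal) (simp add: in_hom)

lemma add_typing [simp]:
  assumes "f \<in> Ar C" "g \<in> Ar C" "src C f = src C g" "tgt C f = tgt C g"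
  shows "f \<oplus> g \<in> Ar C" "src C (f \<oplus> g) = src C g" "tgt C (f \<oplus> g) = tgt C g"
  using add_closed[of f "src C g" "tgt C g" g] assms by (simp_all add: in_hom)

lemma comp_add_distrib:
  assumes f: "f \<in> Ar C" "g \<in> Ar C" "h \<in> Ar C" "src C f = src C g" "tgt C f = tgt C g"
    "src C h = tgt C g"
  shows "h \<cdot> (f \<oplus> g) = h \<cdot> f \<oplus> h \<cdot> g"
proof -
  have fg_hom: "f \<in> hom C (src C g) (tgt C g)" "g \<in> hom C (src C g) (tgt C g)"
    using f by (simp_all add: in_hom)
  obtain P r1 r2 s p where P: "orthonormal_product C (tgt C g) (tgt C g) P r1 r2"
    and s: "s \<in> Ar C" "src C s = P" "tgt C s = tgt C g"
    and s12: "s \<cdot> r1\<^sup>\<dagger> = ident C (tgt C g)" "s \<cdot> r2\<^sup>\<dagger> = ident C (tgt C g)"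
    and p: "p \<in> Ar C" "src C p = src C g" "tgt C p = P"
    and p12: "r1 \<cdot> p = f" "r2 \<cdot> p = g" and fg: "f \<oplus> g = s \<cdot> p"
    using add_as_codiagonal[OF fg_hom] by blast
  note r = orthonormal_productD[OF P]
  have "(h \<cdot> s) \<cdot> p = ((h \<cdot> s) \<cdot> r1\<^sup>\<dagger>) \<cdot> (r1 \<cdot> p) \<oplus> ((h \<cdot> s) \<cdot> r2\<^sup>\<dagger>) \<cdot> (r2 \<cdot> p)"
    by (rule row_comp_column[OF P]) (use p s f in \<open>simp_all add: in_hom\<close>)
  moreover have "(h \<cdot> s) \<cdot> r1\<^sup>\<dagger> = h" "(h \<cdot> s) \<cdot> r2\<^sup>\<dagger> = h"
    using s s12 f r by simp_all
  moreover have "(h \<cdot> s) \<cdot> p = h \<cdot> (f \<oplus> g)"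
    using s p f fg by simp
  ultimately show ?thesis
    by (simp only: p12)
qed

lemma add_comp_distrib:
  assumes f: "f \<in> Ar C" "g \<in> Ar C" "h \<in> Ar C" "src C f = src C g" "tgt C f = tgt C g"
    "src C g = tgt C h"
  shows "(f \<oplus> g) \<cdot> h = f \<cdot> h \<oplus> g \<cdot> h"
proof -
  have fg_hom: "f \<in> hom C (src C g) (tgt C g)" "g \<in> hom C (src C g) (tgt C g)"
    using f by (simp_all add: in_hom)
  obtain P r1 r2 s p where P: "orthonormal_product C (tgt C g) (tgt C g) P r1 r2"
    and s: "s \<in> Ar C" "src C s = P" "tgt C s = tgt C g"
    and s12: "s \<cdot> r1\<^sup>\<dagger> = ident C (tgt C g)" "s \<cdot> r2\<^sup>\<dagger> = ident C (tgt C g)"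
    and p: "p \<in> Ar C" "src C p = src C g" "tgt C p = P"
    and p12: "r1 \<cdot> p = f" "r2 \<cdot> p = g" and fg: "f \<oplus> g = s \<cdot> p"
    using add_as_codiagonal[OF fg_hom] by blast
  note r = orthonormal_productD[OF P]
  have "r1 \<cdot> (p \<cdot> h) \<oplus> r2 \<cdot> (p \<cdot> h) = s \<cdot> (p \<cdot> h)"
    by (rule add_eq_codiagonal[OF P]) (use p s s12 f in \<open>simp_all add: in_hom\<close>)
  moreover have "s \<cdot> (p \<cdot> h) = (s \<cdot> p) \<cdot> h"
    using s p f by simp
  moreover have "r1 \<cdot> (p \<cdot> h) = f \<cdot> h" "r2 \<cdot> (p \<cdot> h) = g \<cdot> h"
    using comp_cancel[OF p12(1)] comp_cancel[OF p12(2)] r p f by simp_all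
  ultimately show ?thesis
    by (simp only: fg)
qed

lemma add_commute:
  assumes f: "f \<in> Ar C" "g \<in> Ar C" "src C f = src C g" "tgt C f = tgt C g"
  shows "f \<oplus> g = g \<oplus> f"
proof -
  have fg_hom: "f \<in> hom C (src C g) (tgt C g)" "g \<in> hom C (src C g) (tgt C g)"
    using f by (simp_all add: in_hom)
  obtain P r1 r2 s p where P: "orthonormal_product C (tgt C g) (tgt C g) P r1 r2"
    and s: "s \<in> Ar C" "src C s = P" "tgt C s = tgt C g"
    and s12: "s \<cdot> r1\<^sup>\<dagger> = ident C (tgt C g)" "s \<cdot> r2\<^sup>\<dagger> = ident C (tgt C g)"
    and p: "p \<in> Ar C" "src C p = src C g" "tgt C p = P"
    and p12: "r1 \<cdot> p = f" "r2 \<cdot> p = g" and fg: "f \<oplus> g = s \<cdot> p"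
    using add_as_codiagonal[OF fg_hom] by blast
  have "r2 \<cdot> p \<oplus> r1 \<cdot> p = s \<cdot> p"
    by (rule add_eq_codiagonal[OF orthonormal_product_swap[OF P]])
      (use p s s12 f in \<open>simp_all add: in_hom\<close>)
  then show ?thesis
    by (simp only: p12 fg)
qed

lemma add_zero:
  assumes f: "f \<in> Ar C" "src C f = X" "tgt C f = Y"
  shows "f \<oplus> zero X Y = f" "zero X Y \<oplus> f = f"
proof -
  have ob: "X \<in> Ob C" "Y \<in> Ob C"
    using f src_closed tgt_closed by blast+
  obtain P r1 r2 s where P: "orthonormal_product C Y Y P r1 r2"
    and s: "s \<in> Ar C" "src C s = P" "tgt C s = Y"
    and s12: "s \<cdot> r1\<^sup>\<dagger> = ident C Y" "s \<cdot> r2\<^sup>\<dagger> = ident C Y"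
    using codiagonal_exists[OF ob(2)] by blast
  note r = orthonormal_productD[OF P]
  have "r1 \<cdot> (r1\<^sup>\<dagger> \<cdot> f) \<oplus> r2 \<cdot> (r1\<^sup>\<dagger> \<cdot> f) = s \<cdot> (r1\<^sup>\<dagger> \<cdot> f)"
    by (rule add_eq_codiagonal[OF P]) (use s s12 f r in \<open>simp_all add: in_hom\<close>)
  moreover have "r1 \<cdot> (r1\<^sup>\<dagger> \<cdot> f) = f" "r2 \<cdot> (r1\<^sup>\<dagger> \<cdot> f) = zero X Y"
    using orthonormal_product_cancel[OF P, of f] f by simp_all
  moreover have "s \<cdot> (r1\<^sup>\<dagger> \<cdot> f) = f"
    using comp_cancel[OF s12(1), of f] s r f by simp
  ultimately show "f \<oplus> zero X Y = f"
    by (simp only:)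
  then show "zero X Y \<oplus> f = f"
    using add_commute[of f "zero X Y"] f ob by simp
qed

text \<open>
  The two sums of pairs into an orthonormal product are computed componentwise and preserved by the
  codiagonal; associativity is the case \<open>h = 0\<close>.
\<close>

lemma add_interchange:
  assumes "f \<in> hom C X Y" "g \<in> hom C X Y" "h \<in> hom C X Y" "k \<in> hom C X Y"
  shows "(f \<oplus> g) \<oplus> (h \<oplus> k) = (f \<oplus> h) \<oplus> (g \<oplus> k)"
proof -
  obtain P r1 r2 s p where P: "orthonormal_product C Y Y P r1 r2"
    and s: "s \<in> Ar C" "src C s = P" "tgt C s = Y"
    and s12: "s \<cdot> r1\<^sup>\<dagger> = ident C Y" "s \<cdot> r2\<^sup>\<dagger> = ident C Y"
    and p: "p \<in> Ar C" "src C p = X" "tgt C p = P"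
    and p12: "r1 \<cdot> p = f" "r2 \<cdot> p = h" and fh: "f \<oplus> h = s \<cdot> p"
    using add_as_codiagonal[OF assms(1,3)] by metis
  note r = orthonormal_productD[OF P]
  obtain q where q: "q \<in> Ar C" "src C q = X" "tgt C q = P" and q12: "r1 \<cdot> q = g" "r2 \<cdot> q = k"
    using pair_exists[OF P assms(2,4)] by blast
  have gk: "r1 \<cdot> q \<oplus> r2 \<cdot> q = s \<cdot> q"
    by (rule add_eq_codiagonal[OF P]) (use s s12 q in \<open>simp_all add: in_hom\<close>)
  have "r1 \<cdot> (p \<oplus> q) \<oplus> r2 \<cdot> (p \<oplus> q) = s \<cdot> (p \<oplus> q)"
    by (rule add_eq_codiagonal[OF P]) (use s s12 p q in \<open>simp_all add: in_hom\<close>)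
  moreover have "r1 \<cdot> (p \<oplus> q) = r1 \<cdot> p \<oplus> r1 \<cdot> q" "r2 \<cdot> (p \<oplus> q) = r2 \<cdot> p \<oplus> r2 \<cdot> q"
    "s \<cdot> (p \<oplus> q) = s \<cdot> p \<oplus> s \<cdot> q"
    by (rule comp_add_distrib; use s p q r in simp)+
  ultimately show ?thesis
    by (simp only: p12 q12 fh gk[symmetric])
qed

lemma add_assoc:
  assumes "f \<in> Ar C" "g \<in> Ar C" "h \<in> Ar C" "src C f = src C g" "tgt C f = tgt C g"
    "src C g = src C h" "tgt C g = tgt C h"
  shows "(f \<oplus> g) \<oplus> h = f \<oplus> (g \<oplus> h)"
  using add_interchange[of f "src C h" "tgt C h" g "zero (src C h) (tgt C h)" h] assms
  by (simp add: in_hom add_zero)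

lemma add_left_commute:
  assumes "f \<in> Ar C" "g \<in> Ar C" "h \<in> Ar C" "src C f = src C g" "tgt C f = tgt C g"
    "src C g = src C h" "tgt C g = tgt C h"
  shows "f \<oplus> (g \<oplus> h) = g \<oplus> (f \<oplus> h)"
  using add_assoc[of f g h] add_assoc[of g f h] add_commute[of f g] assms by simp

lemmas add_ac = add_assoc add_commute add_left_commute

lemma star_add:
  assumes f: "f \<in> Ar C" "g \<in> Ar C" "src C f = src C g" "tgt C f = tgt C g"
  shows "(f \<oplus> g)\<^sup>\<dagger> = f\<^sup>\<dagger> \<oplus> g\<^sup>\<dagger>"
proof -
  have fg_hom: "f \<in> hom C (src C g) (tgt C g)" "g \<in> hom C (src C g) (tgt C g)"
    using f by (simp_all add: in_hom)
  obtain P r1 r2 s p where P: "orthonormal_product C (tgt C g) (tgt C g) P r1 r2"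
    and s: "s \<in> Ar C" "src C s = P" "tgt C s = tgt C g"
    and s12: "s \<cdot> r1\<^sup>\<dagger> = ident C (tgt C g)" "s \<cdot> r2\<^sup>\<dagger> = ident C (tgt C g)"
    and p: "p \<in> Ar C" "src C p = src C g" "tgt C p = P"
    and p12: "r1 \<cdot> p = f" "r2 \<cdot> p = g" and fg: "f \<oplus> g = s \<cdot> p"
    using add_as_codiagonal[OF fg_hom] by blast
  note r = orthonormal_productD[OF P]
  have star_s: "r1 \<cdot> s\<^sup>\<dagger> = (s \<cdot> r1\<^sup>\<dagger>)\<^sup>\<dagger>" "r2 \<cdot> s\<^sup>\<dagger> = (s \<cdot> r2\<^sup>\<dagger>)\<^sup>\<dagger>"
    and star_p: "p\<^sup>\<dagger> \<cdot> r1\<^sup>\<dagger> = (r1 \<cdot> p)\<^sup>\<dagger>" "p\<^sup>\<dagger> \<cdot> r2\<^sup>\<dagger> = (r2 \<cdot> p)\<^sup>\<dagger>"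
    using r s p by simp_all
  have "p\<^sup>\<dagger> \<cdot> s\<^sup>\<dagger> = (p\<^sup>\<dagger> \<cdot> r1\<^sup>\<dagger>) \<cdot> (r1 \<cdot> s\<^sup>\<dagger>) \<oplus> (p\<^sup>\<dagger> \<cdot> r2\<^sup>\<dagger>) \<cdot> (r2 \<cdot> s\<^sup>\<dagger>)"
    by (rule row_comp_column[OF P]) (use p s in \<open>simp_all add: in_hom\<close>)
  also have "\<dots> = f\<^sup>\<dagger> \<cdot> ident C (tgt C g) \<oplus> g\<^sup>\<dagger> \<cdot> ident C (tgt C g)"
    by (simp only: star_s star_p s12 p12 star_ident[OF r(7)])
  also have "\<dots> = f\<^sup>\<dagger> \<oplus> g\<^sup>\<dagger>"
    using f by simp
  finally show ?thesis
    using fg p s by simp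
qed

section \<open>Kernels, cancellation and additive inverses\<close>

lemma kernel_factor:
  assumes k: "is_kernel C m k" and K: "src C k = K"
    and g: "g \<in> Ar C" "tgt C g = tgt C k" "src C g = W" and z: "m \<cdot> g = zero W (tgt C m)"
  obtains u where "u \<in> Ar C" "src C u = W" "tgt C u = K" "k \<cdot> u = g"
proof -
  have m: "m \<in> Ar C" "src C m = tgt C k"
    using k by (simp_all add: is_kernel_def)
  have "zero_arrow C (m \<cdot> g)"
    using z g m src_closed tgt_closed zero_arrow_zero(2) by metis
  then have "\<exists>!u. u \<in> hom C (src C g) (src C k) \<and> k \<cdot> u = g"
    using k g unfolding is_kernel_def by metis
  then show ?thesis
    using that g K by (auto simp: in_hom)
qed

lemma kernel_mono:
  assumes k: "is_kernel C m k" and u: "u \<in> hom C W (src C k)" and v: "v \<in> hom C W (src C k)"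
    and eq: "k \<cdot> u = k \<cdot> v"
  shows "u = v"
proof -
  have kA: "k \<in> Ar C" and m: "m \<in> Ar C" "src C m = tgt C k" and z: "zero_arrow C (m \<cdot> k)"
    using k by (simp_all add: is_kernel_def)
  have uA: "u \<in> Ar C" "src C u = W" "tgt C u = src C k"
    using u by (simp_all add: in_hom)
  have "zero_arrow C ((m \<cdot> k) \<cdot> u)"
    using comp_zero_arrow(2)[OF z uA(1)] m kA uA by simp
  then have "zero_arrow C (m \<cdot> (k \<cdot> u))"
    using m kA uA by simp
  then have "\<exists>!x. x \<in> hom C (src C (k \<cdot> u)) (src C k) \<and> k \<cdot> x = k \<cdot> u"
    using k m kA uA unfolding is_kernel_def by (metis comp_typing)
  then have "\<exists>!x. x \<in> hom C W (src C k) \<and> k \<cdot> x = k \<cdot> u"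
    using kA uA by simp
  then show ?thesis
    using u v eq by metis
qed

lemma kernel_comp_zero:
  assumes "is_kernel C m k"
  shows "m \<cdot> k = zero (src C k) (tgt C m)" "m \<in> Ar C" "k \<in> Ar C" "src C m = tgt C k"
proof -
  show A: "m \<in> Ar C" "k \<in> Ar C" "src C m = tgt C k"
    using assms by (simp_all add: is_kernel_def)
  have "zero_arrow C (m \<cdot> k)"
    using assms by (simp add: is_kernel_def)
  then show "m \<cdot> k = zero (src C k) (tgt C m)"
    using zero_arrow_iff[of "m \<cdot> k"] A by simp
qed

text \<open>
  A kernel differs from an isometric kernel of the same arrow by an isomorphism \<open>v\<close> with inverse
  \<open>w\<close>.
\<close>

lemma kernel_gram_factor:
  assumes d: "is_kernel C m d" "src C d = X"
  obtains K v w where "v \<in> hom C X K" "w \<in> hom C K X" "w \<cdot> v = ident C X" "v \<cdot> w = ident C K"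
    "d\<^sup>\<dagger> \<cdot> d = v\<^sup>\<dagger> \<cdot> v"
proof -
  note dz = kernel_comp_zero[OF d(1)]
  obtain k where k: "is_kernel C m k" and iso: "isometry C k"
    using ex_isometric_kernel[OF dz(2)] by blast
  note kz = kernel_comp_zero[OF k]
  define K where "K = src C k"
  define P where "P = src C m"
  have dA: "d \<in> Ar C" "src C d = X" "tgt C d = P" and kA: "k \<in> Ar C" "src C k = K" "tgt C k = P"
    using dz kz d by (simp_all add: P_def K_def)
  obtain v where v: "v \<in> Ar C" "src C v = X" "tgt C v = K" "k \<cdot> v = d"
    by (rule kernel_factor[OF k kA(2), of d X]) (use dz dA kA in auto)
  obtain w where w: "w \<in> Ar C" "src C w = K" "tgt C w = X" "d \<cdot> w = k"
    by (rule kernel_factor[OF d, of k K]) (use kz dA kA in auto)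
  have ob: "X \<in> Ob C" "K \<in> Ob C"
    using dA kA src_closed by blast+
  have "w \<cdot> v = ident C X"
    by (rule kernel_mono[OF d(1), of _ X])
      (use v w dA comp_cancel[OF w(4), of v] ob in \<open>simp_all add: in_hom\<close>)
  moreover have "v \<cdot> w = ident C K"
    by (rule kernel_mono[OF k, of _ K])
      (use v w kA comp_cancel[OF v(4), of w] ob in \<open>simp_all add: in_hom\<close>)
  moreover have "d\<^sup>\<dagger> \<cdot> d = v\<^sup>\<dagger> \<cdot> v"
  proof -
    have kk: "k\<^sup>\<dagger> \<cdot> k = ident C K"
      using iso kA by (simp add: isometry_def)
    have "d\<^sup>\<dagger> \<cdot> d = (k \<cdot> v)\<^sup>\<dagger> \<cdot> (k \<cdot> v)"
      by (simp only: v(4))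
    also have "\<dots> = v\<^sup>\<dagger> \<cdot> v"
      using v(1-3) kA comp_cancel[OF kk, of v] by simp
    finally show ?thesis .
  qed
  ultimately show ?thesis
    using that v w by (simp add: in_hom)
qed

text \<open>
  An arrow with kernel the diagonal of \<open>X\<close> is a row \<open>(p, q)\<close> such that \<open>p + q = 0\<close> and such that
  \<open>p f + q g = 0\<close> only if \<open>f = g\<close>.
\<close>

lemma diagonal_row:
  assumes P: "orthonormal_product C X X P r1 r2" and d: "is_diagonal C X P r1 r2 d"
    and m: "is_kernel C m d" and M: "tgt C m = M"
  shows "m \<cdot> r1\<^sup>\<dagger> \<oplus> m \<cdot> r2\<^sup>\<dagger> = zero X M"
    and "f \<in> hom C W X \<Longrightarrow> g \<in> hom C W X \<Longrightarrow>
      (m \<cdot> r1\<^sup>\<dagger>) \<cdot> f \<oplus> (m \<cdot> r2\<^sup>\<dagger>) \<cdot> g = zero W M \<Longrightarrow> f = g"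
proof -
  note r = orthonormal_productD[OF P]
  have dA: "d \<in> Ar C" "src C d = X" "tgt C d = P" "r1 \<cdot> d = ident C X" "r2 \<cdot> d = ident C X"
    using d by (auto simp: is_diagonal_def in_hom)
  have mA: "m \<in> Ar C" "src C m = P" "m \<cdot> d = zero X M"
    using kernel_comp_zero[OF m] M dA by auto
  have "m \<cdot> d = (m \<cdot> r1\<^sup>\<dagger>) \<cdot> (r1 \<cdot> d) \<oplus> (m \<cdot> r2\<^sup>\<dagger>) \<cdot> (r2 \<cdot> d)"
    by (rule row_comp_column[OF P]) (use mA dA in \<open>simp_all add: in_hom\<close>)
  also have "\<dots> = m \<cdot> r1\<^sup>\<dagger> \<oplus> m \<cdot> r2\<^sup>\<dagger>"
    using mA dA r by simp
  finally show "m \<cdot> r1\<^sup>\<dagger> \<oplus> m \<cdot> r2\<^sup>\<dagger> = zero X M"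
    by (simp only: mA(3))
  assume fg: "f \<in> hom C W X" "g \<in> hom C W X"
    and z: "(m \<cdot> r1\<^sup>\<dagger>) \<cdot> f \<oplus> (m \<cdot> r2\<^sup>\<dagger>) \<cdot> g = zero W M"
  obtain x where x: "x \<in> Ar C" "src C x = W" "tgt C x = P" "r1 \<cdot> x = f" "r2 \<cdot> x = g"
    using pair_exists[OF P fg] by blast
  have "m \<cdot> x = (m \<cdot> r1\<^sup>\<dagger>) \<cdot> (r1 \<cdot> x) \<oplus> (m \<cdot> r2\<^sup>\<dagger>) \<cdot> (r2 \<cdot> x)"
    by (rule row_comp_column[OF P]) (use mA x in \<open>simp_all add: in_hom\<close>)
  then have mx: "m \<cdot> x = zero W M"
    by (simp only: x z)
  obtain u where u: "u \<in> Ar C" "src C u = W" "tgt C u = X" "d \<cdot> u = x"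
    by (rule kernel_factor[OF m dA(2), of x W]) (use mx x dA M in auto)
  have "f = u" "g = u"
    using u x dA r comp_cancel[OF dA(4), of u] comp_cancel[OF dA(5), of u] by auto
  then show "f = g"
    by simp
qed

lemma diagonal_kernel_exists:
  assumes "X \<in> Ob C"
  obtains P r1 r2 d m where "orthonormal_product C X X P r1 r2" "is_diagonal C X P r1 r2 d"
    "is_kernel C m d"
proof -
  obtain P r1 r2 where P: "orthonormal_product C X X P r1 r2"
    using ex_orthonormal_product[OF assms assms] by blast
  obtain d where "d \<in> Ar C" "src C d = X" "tgt C d = P" "r1 \<cdot> d = ident C X" "r2 \<cdot> d = ident C X"
    using pair_exists[OF P ident_closed[OF assms] ident_closed[OF assms]] by blast
  then have d: "is_diagonal C X P r1 r2 d"
    by (simp add: is_diagonal_def in_hom)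
  then show ?thesis
    using that P diagonal_kernel[OF assms P d] by blast
qed

text \<open>
  Take a row \<open>(p, q)\<close> as in \<open>diagonal_row\<close>. Composing with \<open>p\<close> and adding \<open>q x\<close> turns
  \<open>f + x = g + x\<close> into \<open>p f = p g\<close>; hence \<open>p f + q g = p g + q g = 0\<close>.
\<close>

lemma add_right_cancel:
  assumes f: "f \<in> hom C W X" and g: "g \<in> hom C W X" and x: "x \<in> hom C W X"
    and eq: "f \<oplus> x = g \<oplus> x"
  shows "f = g"
proof -
  have ob: "X \<in> Ob C" "W \<in> Ob C"
    using hom_Ob f by blast+
  obtain P r1 r2 d m where P: "orthonormal_product C X X P r1 r2"
    and d: "is_diagonal C X P r1 r2 d" and m: "is_kernel C m d"
    using diagonal_kernel_exists[OF ob(1)] by metis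
  note r = orthonormal_productD[OF P]
  define M where "M = tgt C m"
  define p where "p = m \<cdot> r1\<^sup>\<dagger>"
  define q where "q = m \<cdot> r2\<^sup>\<dagger>"
  have mA: "m \<in> Ar C" "src C m = P" "tgt C m = M"
    using kernel_comp_zero[OF m] d by (auto simp: is_diagonal_def in_hom M_def)
  have pA: "p \<in> Ar C" "src C p = X" "tgt C p = M" and qA: "q \<in> Ar C" "src C q = X" "tgt C q = M"
    using mA r by (simp_all add: p_def q_def)
  have Mob: "M \<in> Ob C"
    using mA tgt_closed by blast
  note row = diagonal_row[OF P d m M_def[symmetric], folded p_def q_def]
  have kill: "p \<cdot> h \<oplus> q \<cdot> h = zero W M" if "h \<in> hom C W X" for h
    using add_comp_distrib[of p q h] row(1) pA qA that ob Mob by (simp add: in_hom)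
  have fA: "f \<in> Ar C" "src C f = W" "tgt C f = X" and gA: "g \<in> Ar C" "src C g = W" "tgt C g = X"
    and xA: "x \<in> Ar C" "src C x = W" "tgt C x = X"
    using f g x by (simp_all add: in_hom)
  have "p \<cdot> f = p \<cdot> f \<oplus> (p \<cdot> x \<oplus> q \<cdot> x)"
    using kill[OF x] add_zero[of "p \<cdot> f" W M] fA pA by simp
  also have "\<dots> = p \<cdot> (f \<oplus> x) \<oplus> q \<cdot> x"
    using add_assoc[of "p \<cdot> f" "p \<cdot> x" "q \<cdot> x"] comp_add_distrib[of f x p] fA xA pA qA by simp
  also have "\<dots> = p \<cdot> g \<oplus> (p \<cdot> x \<oplus> q \<cdot> x)"
    using add_assoc[of "p \<cdot> g" "p \<cdot> x" "q \<cdot> x"] comp_add_distrib[of g x p] gA xA pA qA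
    by (simp add: eq)
  also have "\<dots> = p \<cdot> g"
    using kill[OF x] add_zero[of "p \<cdot> g" W M] gA pA by simp
  finally have "p \<cdot> f \<oplus> q \<cdot> g = zero W M"
    using kill[OF g] by simp
  then show ?thesis
    by (rule row(2)[OF f g])
qed

lemma add_left_cancel:
  assumes "f \<in> hom C W X" "g \<in> hom C W X" "x \<in> hom C W X" "x \<oplus> f = x \<oplus> g"
  shows "f = g"
  using assms add_right_cancel[OF assms(1-3)] add_commute[of x f] add_commute[of x g]
  by (simp add: in_hom)

text \<open>
  With \<open>d = (1, 1)\<close> and \<open>e\<close> an isometric kernel of \<open>d\<^sup>\<dagger>\<close>, the projections onto the images of \<open>d\<close>
  and \<open>e\<close> are complementary. The off-diagonal entry of their sum is therefore zero; since the
  projection onto the image of \<open>d\<close> has all entries \<open>1/2\<close>, this exhibits \<open>- 1/2\<close>.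
\<close>

lemma minus_ident_exists:
  assumes X: "X \<in> Ob C"
  obtains n where "n \<in> hom C X X" "ident C X \<oplus> n = zero X X"
proof -
  obtain P r1 r2 d m where P: "orthonormal_product C X X P r1 r2"
    and d: "is_diagonal C X P r1 r2 d" and m: "is_kernel C m d"
    using diagonal_kernel_exists[OF X] by metis
  note r = orthonormal_productD[OF P]
  define M where "M = tgt C m"
  have dA: "d \<in> Ar C" "src C d = X" "tgt C d = P" "r1 \<cdot> d = ident C X" "r2 \<cdot> d = ident C X"
    using d by (auto simp: is_diagonal_def in_hom)
  have mA: "m \<in> Ar C" "src C m = P" "tgt C m = M" and md: "m \<cdot> d = zero X M"
    using kernel_comp_zero[OF m] dA by (auto simp: M_def)
  have Mob: "M \<in> Ob C"
    using mA tgt_closed by blast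
  define two where "two = d\<^sup>\<dagger> \<cdot> d"
  have twoA: "two \<in> Ar C" "src C two = X" "tgt C two = X"
    using dA by (simp_all add: two_def)
  have star_d: "d\<^sup>\<dagger> \<cdot> r1\<^sup>\<dagger> = (r1 \<cdot> d)\<^sup>\<dagger>" "d\<^sup>\<dagger> \<cdot> r2\<^sup>\<dagger> = (r2 \<cdot> d)\<^sup>\<dagger>"
    using dA(1-3) r by simp_all
  have dsum: "d\<^sup>\<dagger> \<cdot> x = r1 \<cdot> x \<oplus> r2 \<cdot> x" if "x \<in> hom C W P" for x W
  proof -
    have "r1 \<cdot> x \<oplus> r2 \<cdot> x = d\<^sup>\<dagger> \<cdot> x"
      by (rule add_eq_codiagonal[OF P that])
        (use dA(1-3) in \<open>simp_all add: in_hom star_d dA(4,5) X\<close>)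
    then show ?thesis ..
  qed
  \<comment> \<open>Two is invertible, because the diagonal is a kernel.\<close>
  obtain K v w where vw: "v \<in> hom C X K" "w \<in> hom C K X"
    and wv: "w \<cdot> v = ident C X" "v \<cdot> w = ident C K" and dv: "d\<^sup>\<dagger> \<cdot> d = v\<^sup>\<dagger> \<cdot> v"
    using kernel_gram_factor[OF m dA(2)] by metis
  have vA: "v \<in> Ar C" "src C v = X" "tgt C v = K" and wA: "w \<in> Ar C" "src C w = K" "tgt C w = X"
    using vw by (simp_all add: in_hom)
  define half where "half = w \<cdot> w\<^sup>\<dagger>"
  have halfA: "half \<in> Ar C" "src C half = X" "tgt C half = X"
    using wA by (simp_all add: half_def)
  have vws: "v\<^sup>\<dagger> \<cdot> w\<^sup>\<dagger> = ident C X" "w\<^sup>\<dagger> \<cdot> v\<^sup>\<dagger> = ident C K"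
  proof -
    have "v\<^sup>\<dagger> \<cdot> w\<^sup>\<dagger> = (w \<cdot> v)\<^sup>\<dagger>" "w\<^sup>\<dagger> \<cdot> v\<^sup>\<dagger> = (v \<cdot> w)\<^sup>\<dagger>"
      using vA wA by simp_all
    then show "v\<^sup>\<dagger> \<cdot> w\<^sup>\<dagger> = ident C X" "w\<^sup>\<dagger> \<cdot> v\<^sup>\<dagger> = ident C K"
      using wv X hom_Ob[OF vw(1)] by simp_all
  qed
  have two_half: "two \<cdot> half = ident C X" and half_two: "half \<cdot> two = ident C X"
    using vA wA wv vws comp_cancel[OF wv(2), of "w\<^sup>\<dagger>"] comp_cancel[OF vws(2), of v]
    by (simp_all add: two_def half_def dv)
  \<comment> \<open>An isometric kernel of the codiagonal.\<close>
  obtain e where e: "is_kernel C (d\<^sup>\<dagger>) e" and iso: "isometry C e"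
    using ex_isometric_kernel[of "d\<^sup>\<dagger>"] dA by auto
  define E where "E = src C e"
  have eA: "e \<in> Ar C" "src C e = E" "tgt C e = P" and de: "d\<^sup>\<dagger> \<cdot> e = zero E X"
    using kernel_comp_zero[OF e] dA by (auto simp: E_def)
  have Eob: "E \<in> Ob C"
    using eA src_closed by blast
  have ee: "e\<^sup>\<dagger> \<cdot> e = ident C E"
    using iso eA by (simp add: isometry_def)
  have ed: "e\<^sup>\<dagger> \<cdot> d = zero X E"
  proof -
    have "e\<^sup>\<dagger> \<cdot> d = (d\<^sup>\<dagger> \<cdot> e)\<^sup>\<dagger>"
      using dA eA by simp
    then show ?thesis
      using de Eob X by simp
  qed
  have "d\<^sup>\<dagger> \<cdot> m\<^sup>\<dagger> = (m \<cdot> d)\<^sup>\<dagger>"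
    using dA mA by simp
  then have dm: "d\<^sup>\<dagger> \<cdot> m\<^sup>\<dagger> = zero M X"
    using md X Mob by simp
  obtain u where u: "u \<in> Ar C" "src C u = M" "tgt C u = E" "e \<cdot> u = m\<^sup>\<dagger>"
    by (rule kernel_factor[OF e eA(2), of "m\<^sup>\<dagger>" M]) (use dm dA mA eA in auto)
  have mu: "m = u\<^sup>\<dagger> \<cdot> e\<^sup>\<dagger>"
  proof -
    have "m = (e \<cdot> u)\<^sup>\<dagger>"
      using mA by (simp add: u(4))
    then show ?thesis
      using u(1-3) eA by simp
  qed
  define p where "p = m \<cdot> r1\<^sup>\<dagger>"
  define q where "q = m \<cdot> r2\<^sup>\<dagger>"
  have pA: "p \<in> Ar C" "src C p = X" "tgt C p = M" and qA: "q \<in> Ar C" "src C q = X" "tgt C q = M"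
    using mA r by (simp_all add: p_def q_def)
  \<comment> \<open>The adjoints of \<open>d\<close> and \<open>e\<close> are jointly monic: they determine the sum of the components of an
    arrow, and through \<open>m\<close> also the difference, in the form of an equation free of minus signs.\<close>
  have joint: "x = y" if xy: "x \<in> hom C P P" "y \<in> hom C P P" "d\<^sup>\<dagger> \<cdot> x = d\<^sup>\<dagger> \<cdot> y" "e\<^sup>\<dagger> \<cdot> x = e\<^sup>\<dagger> \<cdot> y" for x y
  proof -
    have xA: "x \<in> Ar C" "src C x = P" "tgt C x = P" and yA: "y \<in> Ar C" "src C y = P" "tgt C y = P"
      using xy by (simp_all add: in_hom)
    define x1 where "x1 = r1 \<cdot> x"
    define x2 where "x2 = r2 \<cdot> x"
    define y1 where "y1 = r1 \<cdot> y"
    define y2 where "y2 = r2 \<cdot> y"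
    have h: "x1 \<in> hom C P X" "x2 \<in> hom C P X" "y1 \<in> hom C P X" "y2 \<in> hom C P X"
      using xA yA r by (simp_all add: x1_def x2_def y1_def y2_def in_hom)
    note hA = h[unfolded in_hom]
    have pq: "p \<cdot> f \<oplus> q \<cdot> f = zero P M" if "f \<in> hom C P X" for f
    proof -
      have "p \<oplus> q = zero X M"
        using diagonal_row(1)[OF P d m M_def[symmetric]] by (simp only: p_def q_def)
      then show ?thesis
        using add_comp_distrib[of p q f] pA qA that r Mob by (simp add: in_hom)
    qed
    have p_mono: "f = g" if fg: "f \<in> hom C P X" "g \<in> hom C P X" and eq: "p \<cdot> f = p \<cdot> g" for f g
      by (rule diagonal_row(2)[OF P d m M_def[symmetric], folded p_def q_def, OF fg])
        (simp only: eq pq[OF fg(2)])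
    have row: "m \<cdot> z = p \<cdot> (r1 \<cdot> z) \<oplus> q \<cdot> (r2 \<cdot> z)" if "z \<in> hom C P P" for z
      unfolding p_def q_def
      by (rule row_comp_column[OF P that]) (use mA in \<open>simp add: in_hom\<close>)
    have "m \<cdot> x = u\<^sup>\<dagger> \<cdot> (e\<^sup>\<dagger> \<cdot> x)" "m \<cdot> y = u\<^sup>\<dagger> \<cdot> (e\<^sup>\<dagger> \<cdot> y)"
      using u(1-3) eA xA yA by (simp_all add: mu)
    then have "m \<cdot> x = m \<cdot> y"
      by (simp only: xy(4))
    then have pqxy: "p \<cdot> x1 \<oplus> q \<cdot> x2 = p \<cdot> y1 \<oplus> q \<cdot> y2"
      using row[OF xy(1)] row[OF xy(2)] by (simp only: x1_def x2_def y1_def y2_def)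
    have "p \<cdot> (x1 \<oplus> y2) \<oplus> q \<cdot> x2 = (p \<cdot> x1 \<oplus> q \<cdot> x2) \<oplus> p \<cdot> y2"
      using hA pA qA by (simp add: comp_add_distrib add_ac)
    also have "\<dots> = p \<cdot> y1 \<oplus> (p \<cdot> y2 \<oplus> q \<cdot> y2)"
      unfolding pqxy using hA pA qA by (simp add: add_ac)
    also have "\<dots> = p \<cdot> y1 \<oplus> (p \<cdot> x2 \<oplus> q \<cdot> x2)"
      using pq h by simp
    also have "\<dots> = p \<cdot> (y1 \<oplus> x2) \<oplus> q \<cdot> x2"
      using hA pA qA by (simp add: comp_add_distrib add_ac)
    finally have "p \<cdot> (x1 \<oplus> y2) = p \<cdot> (y1 \<oplus> x2)"
      by (rule add_right_cancel[of _ P M, rotated -1]) (use hA pA qA in \<open>simp_all add: in_hom\<close>)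
    then have diff_eq: "x1 \<oplus> y2 = y1 \<oplus> x2"
      by (rule p_mono[rotated -1]) (use hA in \<open>simp_all add: in_hom\<close>)
    have sum_eq: "x1 \<oplus> x2 = y1 \<oplus> y2"
      using dsum[OF xy(1)] dsum[OF xy(2)] xy(3) by (simp only: x1_def x2_def y1_def y2_def)
    have "(x1 \<oplus> x1) \<oplus> (x2 \<oplus> y2) = (x1 \<oplus> y2) \<oplus> (x1 \<oplus> x2)"
      using hA by (simp add: add_ac)
    also have "\<dots> = (y1 \<oplus> x2) \<oplus> (y1 \<oplus> y2)"
      by (simp only: diff_eq sum_eq)
    also have "\<dots> = (y1 \<oplus> y1) \<oplus> (x2 \<oplus> y2)"
      using hA by (simp add: add_ac)
    finally have double: "x1 \<oplus> x1 = y1 \<oplus> y1"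
      by (rule add_right_cancel[of _ P X, rotated -1]) (use hA in \<open>simp_all add: in_hom\<close>)
    have halve: "half \<cdot> (z \<oplus> z) = z" if "z \<in> hom C P X" for z
    proof -
      have zA: "z \<in> Ar C" "src C z = P" "tgt C z = X"
        using that by (simp_all add: in_hom)
      have "two = ident C X \<oplus> ident C X"
        using dsum[of d X] dA by (simp add: two_def in_hom)
      then have "z \<oplus> z = two \<cdot> z"
        using add_comp_distrib[of "ident C X" "ident C X" z] X zA by simp
      then show ?thesis
        using comp_cancel[OF half_two, of z] zA halfA twoA by simp
    qed
    have 1: "x1 = y1"
      by (rule trans[OF halve[OF h(1), unfolded double, symmetric] halve[OF h(3)]])
    have 2: "x2 = y2"
      by (rule add_left_cancel[OF h(2) h(4) h(1)]) (rule sum_eq[folded 1])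
    show ?thesis
      by (rule pair_unique[OF P xy(1,2)]) (use 1 2 in \<open>simp_all only: x1_def x2_def y1_def y2_def\<close>)
  qed
  define a where "a = d \<cdot> (half \<cdot> d\<^sup>\<dagger>)"
  define b where "b = e \<cdot> e\<^sup>\<dagger>"
  have aA: "a \<in> Ar C" "src C a = P" "tgt C a = P" and bA: "b \<in> Ar C" "src C b = P" "tgt C b = P"
    using dA eA halfA by (simp_all add: a_def b_def)
  have da: "d\<^sup>\<dagger> \<cdot> a = d\<^sup>\<dagger>" and db: "d\<^sup>\<dagger> \<cdot> b = zero P X"
    using comp_cancel[OF two_def[symmetric], of "half \<cdot> d\<^sup>\<dagger>"] comp_cancel[OF two_half, of "d\<^sup>\<dagger>"]
      comp_cancel[OF de, of "e\<^sup>\<dagger>"] dA eA halfA twoA X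
    by (simp_all add: a_def b_def)
  have ea: "e\<^sup>\<dagger> \<cdot> a = zero P E" and eb: "e\<^sup>\<dagger> \<cdot> b = e\<^sup>\<dagger>"
    using comp_cancel[OF ed, of "half \<cdot> d\<^sup>\<dagger>"] comp_cancel[OF ee, of "e\<^sup>\<dagger>"] dA eA halfA X Eob
    by (simp_all add: a_def b_def)
  have ab: "a \<oplus> b = ident C P"
    by (rule joint)
      (use aA bA dA eA da db ea eb r(9) add_zero[of "d\<^sup>\<dagger>" P X] add_zero[of "e\<^sup>\<dagger>" P E] in
        \<open>simp_all add: in_hom comp_add_distrib\<close>)
  define c where "c = r1 \<cdot> (b \<cdot> r2\<^sup>\<dagger>)"
  have cA: "c \<in> Ar C" "src C c = X" "tgt C c = X"
    using bA r by (simp_all add: c_def)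
  have "r1 \<cdot> (a \<cdot> r2\<^sup>\<dagger>) = half"
  proof -
    have "d\<^sup>\<dagger> \<cdot> r2\<^sup>\<dagger> = ident C X"
      by (simp only: star_d dA star_ident[OF X])
    then show ?thesis
      using comp_cancel[OF dA(4), of half] dA halfA r by (simp add: a_def)
  qed
  moreover have "r1 \<cdot> ((a \<oplus> b) \<cdot> r2\<^sup>\<dagger>) = r1 \<cdot> (a \<cdot> r2\<^sup>\<dagger>) \<oplus> c"
    using aA bA r by (simp add: c_def add_comp_distrib comp_add_distrib)
  moreover have "r1 \<cdot> ((a \<oplus> b) \<cdot> r2\<^sup>\<dagger>) = zero X X"
    unfolding ab using r by simp
  ultimately have "half \<oplus> c = zero X X"
    by simp
  then have "two \<cdot> (half \<oplus> c) = zero X X"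
    using twoA X by simp
  then have "ident C X \<oplus> two \<cdot> c = zero X X"
    using comp_add_distrib[of half c two] twoA halfA cA two_half by simp
  then show ?thesis
    using that[of "two \<cdot> c"] twoA cA by (simp add: in_hom)
qed

lemma minus_exists:
  assumes f: "f \<in> hom C X Y"
  obtains g where "g \<in> hom C X Y" "f \<oplus> g = zero X Y"
proof -
  obtain n where n: "n \<in> hom C X X" "ident C X \<oplus> n = zero X X"
    using minus_ident_exists[OF hom_Ob(1)[OF f]] by metis
  have "f \<oplus> f \<cdot> n = f \<cdot> (ident C X \<oplus> n)"
    using comp_add_distrib[of "ident C X" n f] f n(1) hom_Ob[OF f] by (simp add: in_hom)
  also have "\<dots> = zero X Y"
    using f hom_Ob[OF f] by (simp add: n(2) in_hom)
  finally show ?thesis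
    using that[of "f \<cdot> n"] f n(1) by (simp add: in_hom)
qed

section \<open>The order on Hermitian arrows\<close>

lemma diff_add:
  assumes f: "f \<in> hom C X Y" and g: "g \<in> hom C X Y"
  shows "diff C g f \<in> hom C X Y" "diff C g f \<oplus> f = g"
proof -
  obtain n where n: "n \<in> hom C X Y" "f \<oplus> n = zero X Y"
    using minus_exists[OF f] by metis
  have "(g \<oplus> n) \<oplus> f = g \<oplus> (f \<oplus> n)"
    using f g n(1) by (simp add: in_hom add_ac)
  also have "\<dots> = g"
    using g by (simp add: n(2) add_zero in_hom)
  finally have ex: "g \<oplus> n \<in> hom C X Y \<and> (g \<oplus> n) \<oplus> f = g"
    using add_closed[OF g n(1)] by simp
  have "\<exists>!e. e \<in> hom C X Y \<and> e \<oplus> f = g"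
    using ex add_right_cancel[OF _ _ f] by metis
  from theI'[OF this] have "diff C g f \<in> hom C X Y \<and> diff C g f \<oplus> f = g"
    using g by (simp add: diff_def in_hom)
  then show "diff C g f \<in> hom C X Y" "diff C g f \<oplus> f = g"
    by simp_all
qed

lemma herm_in_hom: "a \<in> Herm C A \<Longrightarrow> a \<in> hom C A A"
  by (simp add: Herm_def)

lemma herm_add: "a \<in> Herm C A \<Longrightarrow> b \<in> Herm C A \<Longrightarrow> a \<oplus> b \<in> Herm C A"
  by (simp add: Herm_def in_hom star_add)

lemma herm_ident: "A \<in> Ob C \<Longrightarrow> ident C A \<in> Herm C A"
  by (simp add: Herm_def in_hom)

lemma herm_minus:
  assumes a: "a \<in> Herm C A"
  obtains n where "n \<in> Herm C A" "a \<oplus> n = zero A A"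
proof -
  have aA: "a \<in> hom C A A" "a \<in> Ar C" "src C a = A" "tgt C a = A" "a\<^sup>\<dagger> = a"
    using a by (simp_all add: Herm_def in_hom)
  obtain n where n: "n \<in> hom C A A" "a \<oplus> n = zero A A"
    using minus_exists[OF aA(1)] by metis
  have "a \<oplus> n\<^sup>\<dagger> = (a \<oplus> n)\<^sup>\<dagger>"
    using n(1) aA by (simp add: star_add in_hom)
  then have "a \<oplus> n\<^sup>\<dagger> = a \<oplus> n"
    using hom_Ob[OF aA(1)] by (simp add: n(2))
  then have "n\<^sup>\<dagger> = n"
    by (rule add_left_cancel[OF star_closed[OF n(1)] n(1) aA(1)])
  then show ?thesis
    using that n by (simp add: Herm_def)
qed

text \<open>A description of the order that avoids subtraction.\<close>

lemma herm_le_iff: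
  "herm_le C A f g \<longleftrightarrow> f \<in> Herm C A \<and> g \<in> Herm C A \<and> (\<exists>X h. h \<in> hom C A X \<and> f \<oplus> h\<^sup>\<dagger> \<cdot> h = g)"
proof (cases "f \<in> Herm C A \<and> g \<in> Herm C A")
  case True
  then have f: "f \<in> hom C A A" and g: "g \<in> hom C A A"
    by (simp_all add: Herm_def)
  have "diff C g f = h\<^sup>\<dagger> \<cdot> h \<longleftrightarrow> f \<oplus> h\<^sup>\<dagger> \<cdot> h = g" if "h \<in> hom C A X" for h X
  proof -
    have hh: "h\<^sup>\<dagger> \<cdot> h \<in> hom C A A"
      using that by (simp add: in_hom)
    have comm: "f \<oplus> h\<^sup>\<dagger> \<cdot> h = h\<^sup>\<dagger> \<cdot> h \<oplus> f"
      by (rule add_commute) (use f hh in \<open>simp_all add: in_hom\<close>)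
    show ?thesis
      unfolding comm using diff_add[OF f g] add_right_cancel[OF _ hh f] by metis
  qed
  with True show ?thesis
    unfolding herm_le_def by metis
qed (auto simp: herm_le_def)

lemma gram_add:
  assumes h: "h \<in> hom C A X" and l: "l \<in> hom C A Y"
  obtains P z where "z \<in> hom C A P" "h\<^sup>\<dagger> \<cdot> h \<oplus> l\<^sup>\<dagger> \<cdot> l = z\<^sup>\<dagger> \<cdot> z"
proof -
  obtain P r1 r2 where P: "orthonormal_product C X Y P r1 r2"
    using ex_orthonormal_product hom_Ob h l by metis
  note r = orthonormal_productD[OF P]
  obtain z where z: "z \<in> Ar C" "src C z = A" "tgt C z = P" and z12: "r1 \<cdot> z = h" "r2 \<cdot> z = l"
    using pair_exists[OF P h l] by blast
  have star_z: "z\<^sup>\<dagger> \<cdot> r1\<^sup>\<dagger> = (r1 \<cdot> z)\<^sup>\<dagger>" "z\<^sup>\<dagger> \<cdot> r2\<^sup>\<dagger> = (r2 \<cdot> z)\<^sup>\<dagger>"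
    using r z by simp_all
  have "z\<^sup>\<dagger> \<cdot> z = (z\<^sup>\<dagger> \<cdot> r1\<^sup>\<dagger>) \<cdot> (r1 \<cdot> z) \<oplus> (z\<^sup>\<dagger> \<cdot> r2\<^sup>\<dagger>) \<cdot> (r2 \<cdot> z)"
    by (rule row_comp_column[OF P]) (use z in \<open>simp_all add: in_hom\<close>)
  then have "h\<^sup>\<dagger> \<cdot> h \<oplus> l\<^sup>\<dagger> \<cdot> l = z\<^sup>\<dagger> \<cdot> z"
    by (simp only: star_z z12)
  then show ?thesis
    using that z by (simp add: in_hom)
qed

lemma herm_le_trans:
  assumes "herm_le C A f g" "herm_le C A g k"
  shows "herm_le C A f k"
proof -
  obtain X h Y l where h: "h \<in> hom C A X" "f \<oplus> h\<^sup>\<dagger> \<cdot> h = g" and l: "l \<in> hom C A Y" "g \<oplus> l\<^sup>\<dagger> \<cdot> l = k"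
    using assms unfolding herm_le_iff by metis
  obtain P z where z: "z \<in> hom C A P" "h\<^sup>\<dagger> \<cdot> h \<oplus> l\<^sup>\<dagger> \<cdot> l = z\<^sup>\<dagger> \<cdot> z"
    using gram_add[OF h(1) l(1)] by metis
  have "(f \<oplus> h\<^sup>\<dagger> \<cdot> h) \<oplus> l\<^sup>\<dagger> \<cdot> l = f \<oplus> (h\<^sup>\<dagger> \<cdot> h \<oplus> l\<^sup>\<dagger> \<cdot> l)"
    by (rule add_assoc) (use assms h(1) l(1) in \<open>simp_all add: herm_le_def Herm_def in_hom\<close>)
  then have "f \<oplus> z\<^sup>\<dagger> \<cdot> z = k"
    by (simp only: h(2) l(2) z(2))
  then show ?thesis
    using assms z(1) unfolding herm_le_iff by blast
qed

lemma herm_le_add_iff: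
  assumes f: "f \<in> Herm C A" and g: "g \<in> Herm C A" and c: "c \<in> Herm C A"
  shows "herm_le C A (f \<oplus> c) (g \<oplus> c) \<longleftrightarrow> herm_le C A f g"
proof -
  note hom = f[THEN herm_in_hom] g[THEN herm_in_hom] c[THEN herm_in_hom]
  have "(f \<oplus> c) \<oplus> h\<^sup>\<dagger> \<cdot> h = g \<oplus> c \<longleftrightarrow> f \<oplus> h\<^sup>\<dagger> \<cdot> h = g" if h: "h \<in> hom C A X" for h X
  proof -
    have fh: "f \<oplus> h\<^sup>\<dagger> \<cdot> h \<in> hom C A A"
      using hom h by (simp add: in_hom)
    have eq: "(f \<oplus> c) \<oplus> h\<^sup>\<dagger> \<cdot> h = (f \<oplus> h\<^sup>\<dagger> \<cdot> h) \<oplus> c"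
      using hom h by (simp add: in_hom add_ac)
    show ?thesis
      unfolding eq using add_right_cancel[OF fh hom(2,3)] by blast
  qed
  then show ?thesis
    unfolding herm_le_iff using herm_add f g c by metis
qed

text \<open>
  The graph \<open>(1, h)\<close> of \<open>h\<close> is a kernel of \<open>r2 - h r1\<close>, so it agrees with an isometry up to an
  isomorphism.
\<close>

lemma ident_plus_gram_factor:
  assumes h: "h \<in> hom C A X"
  obtains K v w where "v \<in> hom C A K" "w \<in> hom C K A" "w \<cdot> v = ident C A" "v \<cdot> w = ident C K"
    "v\<^sup>\<dagger> \<cdot> v = ident C A \<oplus> h\<^sup>\<dagger> \<cdot> h"
proof -
  have ob: "A \<in> Ob C" "X \<in> Ob C"
    using hom_Ob[OF h] by auto
  have hA: "h \<in> Ar C" "src C h = A" "tgt C h = X"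
    using h by (simp_all add: in_hom)
  obtain P r1 r2 where P: "orthonormal_product C A X P r1 r2"
    using ex_orthonormal_product[OF ob] by blast
  note r = orthonormal_productD[OF P]
  obtain d where d: "d \<in> Ar C" "src C d = A" "tgt C d = P" and d12: "r1 \<cdot> d = ident C A" "r2 \<cdot> d = h"
    using pair_exists[OF P ident_closed[OF ob(1)] h] by blast
  obtain k where k: "k \<in> hom C A X" "h \<oplus> k = zero A X"
    using minus_exists[OF h] by metis
  have kA: "k \<in> Ar C" "src C k = A" "tgt C k = X"
    using k by (simp_all add: in_hom)
  define m where "m = r2 \<oplus> k \<cdot> r1"
  have mA: "m \<in> Ar C" "src C m = P" "tgt C m = X"
    using r kA by (simp_all add: m_def)
  have m_comp: "m \<cdot> x = r2 \<cdot> x \<oplus> k \<cdot> (r1 \<cdot> x)" if "x \<in> Ar C" "tgt C x = P" for x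
    using add_comp_distrib[of r2 "k \<cdot> r1" x] that r kA by (simp add: m_def)
  have md: "m \<cdot> d = zero A X"
    using m_comp[OF d(1,3)] d12 k(2) kA by simp
  have kernel: "is_kernel C m d"
    unfolding is_kernel_def
  proof (intro conjI ballI impI)
    show "zero_arrow C (m \<cdot> d)"
      unfolding md by (rule zero_arrow_zero(2)[OF ob])
  next
    fix g
    assume g: "g \<in> Ar C" "tgt C g = src C m" and z: "zero_arrow C (m \<cdot> g)"
    define W where "W = src C g"
    have gA: "g \<in> Ar C" "tgt C g = P" "src C g = W"
      using g mA by (simp_all add: W_def)
    have W: "W \<in> Ob C"
      using gA src_closed by blast
    have mg: "m \<cdot> g = zero W X"
      using z[unfolded zero_arrow_iff] mA gA by simp
    define f where "f = r1 \<cdot> g"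
    have fA: "f \<in> Ar C" "src C f = W" "tgt C f = A"
      using gA r by (simp_all add: f_def)
    have "r2 \<cdot> g \<oplus> k \<cdot> f = zero W X"
      using m_comp[OF gA(1,2)] mg by (simp only: f_def)
    moreover have "h \<cdot> f \<oplus> k \<cdot> f = zero W X"
      using add_comp_distrib[of h k f] k(2) hA kA fA ob W by simp
    ultimately have "r2 \<cdot> g \<oplus> k \<cdot> f = h \<cdot> f \<oplus> k \<cdot> f"
      by (simp only:)
    then have r2g: "r2 \<cdot> g = h \<cdot> f"
      by (rule add_right_cancel[of _ W X, rotated -1])
        (use gA fA hA kA r in \<open>simp_all add: in_hom\<close>)
    have df: "d \<cdot> f = g"
      by (rule pair_unique[OF P, of _ W])
        (use r2g gA fA d r comp_cancel[OF d12(1), of f] comp_cancel[OF d12(2), of f]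
          f_def[symmetric] in \<open>simp_all add: in_hom\<close>)
    show "\<exists>!u. u \<in> hom C (src C g) (src C d) \<and> d \<cdot> u = g"
    proof (rule ex1I)
      show "f \<in> hom C (src C g) (src C d) \<and> d \<cdot> f = g"
        using df fA gA d by (simp add: in_hom)
    next
      fix u assume u: "u \<in> hom C (src C g) (src C d) \<and> d \<cdot> u = g"
      then have uA: "u \<in> Ar C" "src C u = W" "tgt C u = A" "d \<cdot> u = g"
        using gA d by (simp_all add: in_hom)
      show "u = f"
        using comp_cancel[OF d12(1), of u] uA d r by (simp add: f_def)
    qed
  qed (use mA d in auto)
  obtain K v w where v: "v \<in> hom C A K" "w \<in> hom C K A" "w \<cdot> v = ident C A" "v \<cdot> w = ident C K"
    and dv: "d\<^sup>\<dagger> \<cdot> d = v\<^sup>\<dagger> \<cdot> v"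
    using kernel_gram_factor[OF kernel d(2)] by metis
  have star_d: "d\<^sup>\<dagger> \<cdot> r1\<^sup>\<dagger> = (r1 \<cdot> d)\<^sup>\<dagger>" "d\<^sup>\<dagger> \<cdot> r2\<^sup>\<dagger> = (r2 \<cdot> d)\<^sup>\<dagger>"
    using r d by simp_all
  have "d\<^sup>\<dagger> \<cdot> d = (d\<^sup>\<dagger> \<cdot> r1\<^sup>\<dagger>) \<cdot> (r1 \<cdot> d) \<oplus> (d\<^sup>\<dagger> \<cdot> r2\<^sup>\<dagger>) \<cdot> (r2 \<cdot> d)"
    by (rule row_comp_column[OF P]) (use d in \<open>simp_all add: in_hom\<close>)
  also have "\<dots> = ident C A \<oplus> h\<^sup>\<dagger> \<cdot> h"
    using ob by (simp add: star_d d12)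
  finally have "v\<^sup>\<dagger> \<cdot> v = ident C A \<oplus> h\<^sup>\<dagger> \<cdot> h"
    by (simp only: dv)
  with v show ?thesis
    by (rule that)
qed

section \<open>Suprema of nets\<close>

text \<open>
  Conjugating \<open>v\<^sup>\<dagger> v \<le> v'\<^sup>\<dagger> v'\<close> by a right inverse \<open>w'\<close> of \<open>v'\<close> gives \<open>(v w')\<^sup>\<dagger> (v w') \<le> 1\<close>.
\<close>

lemma contraction_comp_inverse:
  assumes v: "v \<in> hom C A X" and v': "v' \<in> hom C A Y" and w': "w' \<in> hom C Y A"
    and inv: "v' \<cdot> w' = ident C Y"
    and le: "herm_le C A (v\<^sup>\<dagger> \<cdot> v) (v'\<^sup>\<dagger> \<cdot> v')"
  shows "contraction C (v \<cdot> w')"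
proof -
  obtain Z l where l: "l \<in> hom C A Z" and eq: "v\<^sup>\<dagger> \<cdot> v \<oplus> l\<^sup>\<dagger> \<cdot> l = v'\<^sup>\<dagger> \<cdot> v'"
    using le unfolding herm_le_iff by blast
  have Y: "Y \<in> Ob C"
    using hom_Ob[OF w'] by simp
  have vA: "v \<in> Ar C" "src C v = A" "tgt C v = X" and vA': "v' \<in> Ar C" "src C v' = A" "tgt C v' = Y"
    and wA: "w' \<in> Ar C" "src C w' = Y" "tgt C w' = A" and lA: "l \<in> Ar C" "src C l = A" "tgt C l = Z"
    using v v' w' l by (simp_all add: in_hom)
  have "w'\<^sup>\<dagger> \<cdot> v'\<^sup>\<dagger> = (v' \<cdot> w')\<^sup>\<dagger>"
    using vA' wA by simp
  then have inv_star: "w'\<^sup>\<dagger> \<cdot> v'\<^sup>\<dagger> = ident C Y"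
    using Y by (simp add: inv)
  have "(v \<cdot> w')\<^sup>\<dagger> \<cdot> (v \<cdot> w') \<oplus> (l \<cdot> w')\<^sup>\<dagger> \<cdot> (l \<cdot> w') = w'\<^sup>\<dagger> \<cdot> ((v\<^sup>\<dagger> \<cdot> v \<oplus> l\<^sup>\<dagger> \<cdot> l) \<cdot> w')"
    using vA wA lA by (simp add: comp_add_distrib add_comp_distrib)
  also have "\<dots> = (w'\<^sup>\<dagger> \<cdot> v'\<^sup>\<dagger>) \<cdot> (v' \<cdot> w')"
    unfolding eq using vA' wA by simp
  also have "\<dots> = ident C Y"
    using Y by (simp add: inv inv_star)
  finally have *: "(v \<cdot> w')\<^sup>\<dagger> \<cdot> (v \<cdot> w') \<oplus> (l \<cdot> w')\<^sup>\<dagger> \<cdot> (l \<cdot> w') = ident C Y" .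
  have herm: "(v \<cdot> w')\<^sup>\<dagger> \<cdot> (v \<cdot> w') \<in> Herm C Y"
    using vA wA by (simp add: Herm_def in_hom)
  have lw: "l \<cdot> w' \<in> hom C Y Z"
    using lA wA by (simp add: in_hom)
  have "herm_le C Y ((v \<cdot> w')\<^sup>\<dagger> \<cdot> (v \<cdot> w')) (ident C Y)"
    unfolding herm_le_iff using herm herm_ident[OF Y] lw * by blast
  then show ?thesis
    using vA wA by (simp add: contraction_def)
qed

text \<open>
  A net of Gram arrows of isomorphisms \<open>v j\<close> is the net of an \<open>\<ell>\<^sup>2\<close>-cone on the diagram of
  comparison arrows \<open>v j (v k)\<^sup>-\<^sup>1\<close>.
\<close>

lemma gram_net_has_supremum:
  fixes J :: "'j set"
  assumes lims: "\<And>(J :: 'j set) r X f. diagram_of_contractions C J r X f \<Longrightarrow> \<exists>L p. l2_limit C J r X f L p"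
    and net: "increasing_net C A J r (\<lambda>j. (v j)\<^sup>\<dagger> \<cdot> v j)"
    and A: "A \<in> Ob C"
    and v: "\<And>j. j \<in> J \<Longrightarrow> v j \<in> hom C A (X j)" and w: "\<And>j. j \<in> J \<Longrightarrow> w j \<in> hom C (X j) A"
    and wv: "\<And>j. j \<in> J \<Longrightarrow> w j \<cdot> v j = ident C A" and vw: "\<And>j. j \<in> J \<Longrightarrow> v j \<cdot> w j = ident C (X j)"
    and bound: "upper_bound C A J (\<lambda>j. (v j)\<^sup>\<dagger> \<cdot> v j) b"
  shows "\<exists>s. is_supremum C A J (\<lambda>j. (v j)\<^sup>\<dagger> \<cdot> v j) s"
proof -
  define f where "f j k = v j \<cdot> w k" for j k
  have vA: "v j \<in> Ar C" "src C (v j) = A" "tgt C (v j) = X j"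
    and wA: "w j \<in> Ar C" "src C (w j) = X j" "tgt C (w j) = A" if "j \<in> J" for j
    using v[OF that] w[OF that] by (simp_all add: in_hom)
  have dir: "directed_set J r"
    and le: "\<And>j k. j \<in> J \<Longrightarrow> k \<in> J \<Longrightarrow> (j, k) \<in> r \<Longrightarrow> herm_le C A ((v j)\<^sup>\<dagger> \<cdot> v j) ((v k)\<^sup>\<dagger> \<cdot> v k)"
    using net by (auto simp: increasing_net_def)
  have f_hom: "f j k \<in> hom C (X k) (X j)" if "j \<in> J" "k \<in> J" for j k
    using vA[OF that(1)] wA[OF that(2)] by (simp add: f_def in_hom)
  have f_comp: "f j k \<cdot> f k l = f j l" if "j \<in> J" "k \<in> J" "l \<in> J" for j k l
    using vA[OF that(1)] vA[OF that(2)] wA[OF that(2)] wA[OF that(3)]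
      comp_cancel[OF wv[OF that(2)], of "w l"]
    by (simp add: f_def)
  have f_cone: "f j k \<cdot> v k = v j" if "j \<in> J" "k \<in> J" for j k
    using vA[OF that(1)] vA[OF that(2)] wA[OF that(2)] wv[OF that(2)] by (simp add: f_def)
  have "codirected_diagram C J r X f"
    unfolding codirected_diagram_def
    using dir f_hom f_comp vw hom_Ob(2)[OF v] by (auto simp: f_def)
  moreover have "contraction C (f j k)" if "j \<in> J" "k \<in> J" "(j, k) \<in> r" for j k
    unfolding f_def using contraction_comp_inverse[OF v v w vw le] that by blast
  ultimately have "diagram_of_contractions C J r X f"
    by (simp add: diagram_of_contractions_def)
  then obtain L p where lim: "l2_limit C J r X f L p"
    using lims by blast
  have cone: "l2_cone C J r X f A v"
    using A v f_cone bound by (auto simp: l2_cone_def cone_def)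
  obtain u where "u \<in> hom C A L \<and> (\<forall>j\<in>J. p j \<cdot> u = v j)"
    using lim cone unfolding l2_limit_def by blast
  then show ?thesis
    using lim cone unfolding l2_limit_def by blast
qed

lemma increasing_net_has_supremum:
  fixes J :: "'j set"
  assumes lims: "\<And>(J :: 'j set) r X f. diagram_of_contractions C J r X f \<Longrightarrow> \<exists>L p. l2_limit C J r X f L p"
    and net: "increasing_net C A J r a" and A: "A \<in> Ob C" and bound: "upper_bound C A J a b"
  shows "\<exists>s. is_supremum C A J a s"
proof -
  have dir: "directed_set J r" and a: "\<And>j. j \<in> J \<Longrightarrow> a j \<in> Herm C A"
    and le: "\<And>j k. j \<in> J \<Longrightarrow> k \<in> J \<Longrightarrow> (j, k) \<in> r \<Longrightarrow> herm_le C A (a j) (a k)"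
    using net by (auto simp: increasing_net_def)
  obtain j0 where j0: "j0 \<in> J"
    using dir by (auto simp: directed_set_def)
  define J0 where "J0 = {j \<in> J. (j0, j) \<in> r}"
  define r0 where "r0 = r \<inter> J0 \<times> J0"
  have sub: "j \<in> J" "(j0, j) \<in> r" if "j \<in> J0" for j
    using that by (auto simp: J0_def)
  have refl: "\<And>j. j \<in> J \<Longrightarrow> (j, j) \<in> r" and tr: "\<And>j k l. (j, k) \<in> r \<Longrightarrow> (k, l) \<in> r \<Longrightarrow> (j, l) \<in> r"
    and up: "\<And>j k. j \<in> J \<Longrightarrow> k \<in> J \<Longrightarrow> \<exists>l\<in>J. (j, l) \<in> r \<and> (k, l) \<in> r"
    using dir by (auto simp: directed_set_def preorder_on_def refl_on_def dest: transD)
  have cofinal: "\<exists>l\<in>J0. (j, l) \<in> r" if "j \<in> J" for j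
    using up[OF j0 that] by (auto simp: J0_def)
  have dir0: "directed_set J0 r0"
    unfolding directed_set_def
  proof (intro conjI ballI)
    show "J0 \<noteq> {}"
      using cofinal[OF j0] by blast
    show "preorder_on J0 r0"
      using refl sub tr by (auto simp: preorder_on_def refl_on_def r0_def intro!: transI)
    fix j k assume jk: "j \<in> J0" "k \<in> J0"
    then obtain l where l: "l \<in> J" "(j, l) \<in> r" "(k, l) \<in> r"
      using up sub by blast
    then have "l \<in> J0"
      using sub[OF jk(1)] tr by (auto simp: J0_def)
    with l jk show "\<exists>l\<in>J0. (j, l) \<in> r0 \<and> (k, l) \<in> r0"
      by (auto simp: r0_def)
  qed
  \<comment> \<open>Shifting the net by \<open>1 - a j0\<close> makes its tail consist of Gram arrows of isomorphisms.\<close>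
  have "\<exists>K v w. v \<in> hom C A K \<and> w \<in> hom C K A \<and> w \<cdot> v = ident C A \<and> v \<cdot> w = ident C K \<and>
      v\<^sup>\<dagger> \<cdot> v \<oplus> a j0 = ident C A \<oplus> a j" if j: "j \<in> J0" for j
  proof -
    obtain X h where h: "h \<in> hom C A X" "a j0 \<oplus> h\<^sup>\<dagger> \<cdot> h = a j"
      using le[OF j0 sub[OF j]] unfolding herm_le_iff by blast
    obtain K v w where vw: "v \<in> hom C A K" "w \<in> hom C K A" "w \<cdot> v = ident C A" "v \<cdot> w = ident C K"
      and gram: "v\<^sup>\<dagger> \<cdot> v = ident C A \<oplus> h\<^sup>\<dagger> \<cdot> h"
      using ident_plus_gram_factor[OF h(1)] by metis
    have "v\<^sup>\<dagger> \<cdot> v \<oplus> a j0 = ident C A \<oplus> (a j0 \<oplus> h\<^sup>\<dagger> \<cdot> h)"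
      unfolding gram using herm_in_hom[OF a[OF j0]] h(1) A by (simp add: in_hom add_ac)
    then show ?thesis
      using vw h(2) by metis
  qed
  then obtain X v w where v: "\<And>j. j \<in> J0 \<Longrightarrow> v j \<in> hom C A (X j)"
    and w: "\<And>j. j \<in> J0 \<Longrightarrow> w j \<in> hom C (X j) A"
    and wv: "\<And>j. j \<in> J0 \<Longrightarrow> w j \<cdot> v j = ident C A" and vw: "\<And>j. j \<in> J0 \<Longrightarrow> v j \<cdot> w j = ident C (X j)"
    and shift: "\<And>j. j \<in> J0 \<Longrightarrow> (v j)\<^sup>\<dagger> \<cdot> v j \<oplus> a j0 = ident C A \<oplus> a j"
    by metis
  define c where "c j = (v j)\<^sup>\<dagger> \<cdot> v j" for j
  note one = herm_ident[OF A]
  have c: "c j \<in> Herm C A" if "j \<in> J0" for j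
    using v[OF that] by (simp add: c_def Herm_def in_hom)
  have comm: "x \<oplus> y = y \<oplus> x" if "x \<in> Herm C A" "y \<in> Herm C A" for x y
    by (rule add_commute) (use that in \<open>simp_all add: Herm_def in_hom\<close>)
  \<comment> \<open>The relation \<open>y + a j0 = 1 + x\<close> between Hermitian arrows says that \<open>y\<close> is the shift of \<open>x\<close>.\<close>
  have transfer: "herm_le C A (c j) y \<longleftrightarrow> herm_le C A (a j) x"
    if "j \<in> J0" "x \<in> Herm C A" "y \<in> Herm C A" "y \<oplus> a j0 = ident C A \<oplus> x" for j x y
  proof -
    have "herm_le C A (c j) y \<longleftrightarrow> herm_le C A (c j \<oplus> a j0) (y \<oplus> a j0)"
      using herm_le_add_iff[OF c[OF that(1)] that(3) a[OF j0]] by simp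
    also have "\<dots> \<longleftrightarrow> herm_le C A (a j \<oplus> ident C A) (x \<oplus> ident C A)"
      using shift[OF that(1)] that comm[OF one] a sub by (simp add: c_def)
    also have "\<dots> \<longleftrightarrow> herm_le C A (a j) x"
      using herm_le_add_iff a sub that one by blast
    finally show ?thesis .
  qed
  obtain n where n: "n \<in> Herm C A" "a j0 \<oplus> n = zero A A"
    using herm_minus[OF a[OF j0]] by metis
  obtain n1 where n1: "n1 \<in> Herm C A" "ident C A \<oplus> n1 = zero A A"
    using herm_minus[OF one] by metis
  have shift_bound: "\<exists>y \<in> Herm C A. y \<oplus> a j0 = ident C A \<oplus> x" if x: "x \<in> Herm C A" for x
  proof
    have "((ident C A \<oplus> x) \<oplus> n) \<oplus> a j0 = (ident C A \<oplus> x) \<oplus> (a j0 \<oplus> n)"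
      using n(1) x one a[OF j0] by (simp add: Herm_def in_hom add_ac)
    then show "((ident C A \<oplus> x) \<oplus> n) \<oplus> a j0 = ident C A \<oplus> x"
      using x one by (simp add: n(2) add_zero Herm_def in_hom)
  qed (use x one n(1) herm_add in blast)
  have unshift: "\<exists>x \<in> Herm C A. y \<oplus> a j0 = ident C A \<oplus> x" if y: "y \<in> Herm C A" for y
  proof
    have "ident C A \<oplus> ((y \<oplus> a j0) \<oplus> n1) = (y \<oplus> a j0) \<oplus> (ident C A \<oplus> n1)"
      using n1(1) y one a[OF j0] by (simp add: Herm_def in_hom add_ac)
    then show "y \<oplus> a j0 = ident C A \<oplus> ((y \<oplus> a j0) \<oplus> n1)"
      using y one a[OF j0] by (simp add: n1(2) add_zero Herm_def in_hom)
  qed (use y one n1(1) herm_add a[OF j0] in blast)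
  have bound_iff: "upper_bound C A J0 c y \<longleftrightarrow> upper_bound C A J a x"
    if "x \<in> Herm C A" "y \<in> Herm C A" "y \<oplus> a j0 = ident C A \<oplus> x" for x y
  proof -
    have "upper_bound C A J0 c y \<longleftrightarrow> (\<forall>j\<in>J0. herm_le C A (a j) x)"
      using transfer that by (auto simp: upper_bound_def)
    also have "\<dots> \<longleftrightarrow> (\<forall>j\<in>J. herm_le C A (a j) x)"
      using cofinal sub le herm_le_trans by meson
    finally show ?thesis
      using that by (simp add: upper_bound_def)
  qed
  have net0: "increasing_net C A J0 r0 c"
    unfolding increasing_net_def
  proof (intro conjI ballI impI dir0 c)
    fix j k assume jk: "j \<in> J0" "k \<in> J0" "(j, k) \<in> r0"
    have "herm_le C A (a j) (a k)"
      using jk sub le by (auto simp: r0_def)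
    then show "herm_le C A (c j) (c k)"
      using transfer[OF jk(1) a[OF sub(1)[OF jk(2)]] c[OF jk(2)]] shift[OF jk(2)] by (simp add: c_def)
  qed
  have "b \<in> Herm C A"
    using bound by (simp add: upper_bound_def)
  then obtain b' where "upper_bound C A J0 c b'"
    using shift_bound bound_iff bound by blast
  then obtain s where s: "is_supremum C A J0 c s"
    using gram_net_has_supremum[OF lims net0[unfolded c_def] A v w wv vw] unfolding c_def by blast
  then have sH: "s \<in> Herm C A"
    by (simp add: is_supremum_def upper_bound_def)
  then obtain s' where s': "s' \<in> Herm C A" "s \<oplus> a j0 = ident C A \<oplus> s'"
    using unshift by blast
  have "herm_le C A s' x" if x: "upper_bound C A J a x" for x
  proof -
    have xH: "x \<in> Herm C A"
      using x by (simp add: upper_bound_def)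
    then obtain y where y: "y \<in> Herm C A" "y \<oplus> a j0 = ident C A \<oplus> x"
      using shift_bound by blast
    then have "upper_bound C A J0 c y"
      using bound_iff xH x by blast
    then have "herm_le C A (s \<oplus> a j0) (y \<oplus> a j0)"
      using s herm_le_add_iff[OF sH y(1) a[OF j0]] by (simp add: is_supremum_def)
    then have "herm_le C A (s' \<oplus> ident C A) (x \<oplus> ident C A)"
      by (simp only: s'(2) y(2) comm[OF one s'(1)] comm[OF one xH])
    then show ?thesis
      using herm_le_add_iff[OF s'(1) xH one] by simp
  qed
  moreover have "upper_bound C A J a s'"
    using s bound_iff[OF s'(1) sH s'(2)] by (simp add: is_supremum_def)
  ultimately show ?thesis
    unfolding is_supremum_def by blast
qed

end

theorem theorem3p8:
  fixes C :: "('o, 'm) star_cat"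
  assumes "hilbert_star_category C TYPE('j)"
  shows "monotone_complete C TYPE('j)"
proof -
  interpret pre_hilbert_star_category C
    using assms by (simp add: hilbert_star_category_def)
  have "\<exists>L p. l2_limit C J r X f L p" if "diagram_of_contractions C J r X f"
    for J :: "'j set" and r X f
    using assms that by (simp add: hilbert_star_category_def)
  then show ?thesis
    unfolding monotone_complete_def using increasing_net_has_supremum by blast
qed

end
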